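(* Let $m$ be a nonnegative integer and let $Y$ be a path-connected topological manifold (without boundary) such that $\dim(Y)\leq \dfrac{m}{2}$. Let $A$ denote the antipodal involution $A(x)=-x$ on spheres. Then: (1) The triple $\left((S^{m+1},A);Y\right)$ satisfies the Borsuk-Ulam property (BUP). (2) If $\mathrm{hdim}(D(Y,2))\leq 2\dim(Y)-1$, then $\left((S^{m},A);Y\right)$ satisfies the BUP.
   Context: For a Hausdorff space $X$ with a (continuous) fixed-point free involution $\tau$ and a Hausdorff space $Y$, the triple $\left((X,\tau);Y\right)$ satisfies the Borsuk-Ulam property (BUP) if for every continuous map $f:X\to Y$ there exists $x\in X$ with $f(\tau(x))=f(x)$. $F(Y,2)=\{(y_1,y_2)\in Y\times Y: y_1\neq y_2\}$ with the subspace topology, and $D(Y,2)$ is the quotient of $F(Y,2)$ by the involution $(y_1,y_2)\mapsto(y_2,y_1)$. $\mathrm{hdim}(Z)$ denotes the homotopical dimension of $Z$, i.e. the minimal dimension of CW complexes having the homotopy type of $Z$. *)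

theory Defs
  imports "HOL-Analysis.Analysis"
begin

section \<open>Free involutions and the Borsuk-Ulam property\<close>

definition free_involution :: "'a topology \<Rightarrow> ('a \<Rightarrow> 'a) \<Rightarrow> bool" where
  "free_involution X \<tau> \<longleftrightarrow>
     continuous_map X X \<tau> \<and> (\<forall>x\<in>topspace X. \<tau> (\<tau> x) = x \<and> \<tau> x \<noteq> x)"

text \<open>The property is meant for Hausdorff \<open>X\<close>, \<open>Y\<close> and a free involution \<open>\<tau>\<close> of \<open>X\<close>.
  For antipodal spheres these requirements are the lemmas
  \<open>free_involution_antipode\<close> and \<open>Hausdorff_space_nsphere\<close> below.\<close>

definition BUP :: "'a topology \<Rightarrow> ('a \<Rightarrow> 'a) \<Rightarrow> 'b topology \<Rightarrow> bool" where
  "BUP X \<tau> Y \<longleftrightarrow> (\<forall>f. continuous_map X Y f \<longrightarrow> (\<exists>x\<in>topspace X. f (\<tau> x) = f x))"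

definition antipode :: "(nat \<Rightarrow> real) \<Rightarrow> nat \<Rightarrow> real" where
  "antipode x = (\<lambda>i. - x i)"

lemma Hausdorff_space_nsphere: "Hausdorff_space (nsphere n)"
  unfolding nsphere
  by (intro Hausdorff_space_subtopology) (simp add: Hausdorff_space_product_topology)

lemma free_involution_antipode: "free_involution (nsphere n) antipode"
proof -
  have "continuous_map (powertop_real UNIV) euclideanreal (\<lambda>x. - x i)" for i :: nat
    by (intro continuous_map_minus continuous_map_product_projection) simp
  then have "continuous_map (nsphere n) (nsphere n) antipode"
    by (auto simp: nsphere antipode_def continuous_map_in_subtopology
        continuous_map_componentwise_UNIV intro!: continuous_map_from_subtopology)
  moreover have "antipode (antipode x) = x \<and> antipode x \<noteq> x"
    if "x \<in> topspace (nsphere n)" for x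
  proof -
    have "x \<noteq> (\<lambda>i. 0)" using that by (auto simp: nsphere)
    then show ?thesis by (auto simp: antipode_def fun_eq_iff)
  qed
  ultimately show ?thesis by (simp add: free_involution_def)
qed


section \<open>Topological manifolds without boundary\<close>

definition topological_manifold :: "nat \<Rightarrow> 'a topology \<Rightarrow> bool" where
  "topological_manifold n Y \<longleftrightarrow>
     Hausdorff_space Y \<and> second_countable Y \<and>
     (\<forall>y\<in>topspace Y. \<exists>U V. openin Y U \<and> y \<in> U \<and> openin (Euclidean_space n) V \<and>
        subtopology Y U homeomorphic_space subtopology (Euclidean_space n) V)"


section \<open>Configuration spaces of two points\<close>

definition quotient_topology :: "'a topology \<Rightarrow> ('a \<Rightarrow> 'b) \<Rightarrow> 'b topology" where
  "quotient_topology X q =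
     topology (\<lambda>U. U \<subseteq> q ` topspace X \<and> openin X {x \<in> topspace X. q x \<in> U})"

lemma openin_quotient_topology:
  "openin (quotient_topology X q) U \<longleftrightarrow>
     U \<subseteq> q ` topspace X \<and> openin X {x \<in> topspace X. q x \<in> U}"
proof -
  have "istopology (\<lambda>U. U \<subseteq> q ` topspace X \<and> openin X {x \<in> topspace X. q x \<in> U})"
    unfolding istopology_def
  proof (intro conjI allI impI)
    fix S T assume "S \<subseteq> q ` topspace X \<and> openin X {x \<in> topspace X. q x \<in> S}"
      and "T \<subseteq> q ` topspace X \<and> openin X {x \<in> topspace X. q x \<in> T}"
    moreover have "{x \<in> topspace X. q x \<in> S \<inter> T}
        = {x \<in> topspace X. q x \<in> S} \<inter> {x \<in> topspace X. q x \<in> T}" by auto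
    ultimately show "S \<inter> T \<subseteq> q ` topspace X" "openin X {x \<in> topspace X. q x \<in> S \<inter> T}"
      by auto
  next
    fix \<K> assume *: "\<forall>K\<in>\<K>. K \<subseteq> q ` topspace X \<and> openin X {x \<in> topspace X. q x \<in> K}"
    then show "\<Union>\<K> \<subseteq> q ` topspace X" by blast
    have "{x \<in> topspace X. q x \<in> \<Union>\<K>} = (\<Union>K\<in>\<K>. {x \<in> topspace X. q x \<in> K})" by auto
    with * show "openin X {x \<in> topspace X. q x \<in> \<Union>\<K>}" by auto
  qed
  then show ?thesis by (simp add: quotient_topology_def)
qed

lemma topspace_quotient_topology: "topspace (quotient_topology X q) = q ` topspace X"
proof -
  have "openin (quotient_topology X q) (q ` topspace X)"
  proof -
    have "{x \<in> topspace X. q x \<in> q ` topspace X} = topspace X" by auto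
    then show ?thesis by (simp add: openin_quotient_topology)
  qed
  then show ?thesis
    by (meson openin_quotient_topology openin_subset openin_topspace subset_antisym)
qed

lemma quotient_map_quotient_topology: "quotient_map X (quotient_topology X q) q"
  by (auto simp: quotient_map_def topspace_quotient_topology openin_quotient_topology)

definition ordered_config2 :: "'a topology \<Rightarrow> ('a \<times> 'a) topology" where
  "ordered_config2 Y = subtopology (prod_topology Y Y) {(y1, y2). y1 \<noteq> y2}"

definition unordered_config2 :: "'a topology \<Rightarrow> ('a \<times> 'a) set topology" where
  "unordered_config2 Y = quotient_topology (ordered_config2 Y) (\<lambda>p. {p, prod.swap p})"


section \<open>CW complexes and homotopical dimension\<close>

definition closed_disc :: "nat \<Rightarrow> (nat \<Rightarrow> real) topology" where
  "closed_disc n = subtopology (Euclidean_space n) {x. (\<Sum>i<n. x i ^ 2) \<le> 1}"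

definition disc_interior :: "nat \<Rightarrow> (nat \<Rightarrow> real) set" where
  "disc_interior n = {x \<in> topspace (Euclidean_space n). (\<Sum>i<n. x i ^ 2) < 1}"

definition disc_boundary :: "nat \<Rightarrow> (nat \<Rightarrow> real) set" where
  "disc_boundary n = {x \<in> topspace (Euclidean_space n). (\<Sum>i<n. x i ^ 2) = 1}"

text \<open>\<open>E n\<close> is the set of open \<open>n\<close>-cells.  For \<open>n = 0\<close> the disc is a point with empty boundary.\<close>

definition characteristic_map ::
    "'a topology \<Rightarrow> (nat \<Rightarrow> 'a set set) \<Rightarrow> nat \<Rightarrow> 'a set \<Rightarrow> ((nat \<Rightarrow> real) \<Rightarrow> 'a) \<Rightarrow> bool" where
  "characteristic_map X E n e \<phi> \<longleftrightarrow>
     continuous_map (closed_disc n) X \<phi> \<and>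
     homeomorphic_map (subtopology (closed_disc n) (disc_interior n)) (subtopology X e) \<phi> \<and>
     (\<exists>F. finite F \<and> F \<subseteq> (\<Union>k<n. E k) \<and> \<phi> ` disc_boundary n \<subseteq> \<Union>F)"

text \<open>Whitehead's definition: a Hausdorff space partitioned into cells, closure-finite
  (the finite \<open>F\<close> above) and carrying the weak topology.\<close>

definition CW_complex :: "'a topology \<Rightarrow> (nat \<Rightarrow> 'a set set) \<Rightarrow> bool" where
  "CW_complex X E \<longleftrightarrow>
     Hausdorff_space X \<and>
     (\<Union>n. \<Union>(E n)) = topspace X \<and>
     (\<forall>m n. \<forall>d\<in>E m. \<forall>e\<in>E n. (m, d) \<noteq> (n, e) \<longrightarrow> d \<inter> e = {}) \<and>
     (\<forall>n. \<forall>e\<in>E n. \<exists>\<phi>. characteristic_map X E n e \<phi>) \<and>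
     (\<forall>A\<subseteq>topspace X. (\<forall>n. \<forall>e\<in>E n. closedin X (A \<inter> X closure_of e)) \<longrightarrow> closedin X A)"

text \<open>Dimensions are extended reals: \<open>\<infinity>\<close> if there are cells of arbitrarily high dimension,
  \<open>-\<infinity>\<close> for the empty complex.\<close>

definition CW_dim :: "(nat \<Rightarrow> 'a set set) \<Rightarrow> ereal" where
  "CW_dim E = (SUP n\<in>{n. E n \<noteq> {}}. ereal (real n))"

text \<open>Since HOL cannot quantify over types, the type \<open>'b\<close> carrying the competing CW complexes is a
  parameter.  The infimum is a minimum if some complex competes and \<open>\<infinity>\<close> otherwise, so for real \<open>k\<close>
  the bound \<open>hdim TYPE('b) Z \<le> k\<close> says that some CW complex on \<open>'b\<close> of dimension at most \<open>k\<close> has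
  the homotopy type of \<open>Z\<close> (lemma \<open>hdim_le_iff\<close>).  A theorem assuming this bound with \<open>'b\<close> free
  therefore covers CW complexes on arbitrary types.\<close>

definition hdim :: "'b itself \<Rightarrow> 'a topology \<Rightarrow> ereal" where
  "hdim _ Z = (INF (X, E) \<in> {(X :: 'b topology, E). CW_complex X E \<and> X homotopy_equivalent_space Z}.
     CW_dim E)"

lemma hdim_le_iff:
  "hdim TYPE('b) Z \<le> ereal k \<longleftrightarrow>
     (\<exists>(X :: 'b topology) E. CW_complex X E \<and> X homotopy_equivalent_space Z \<and> CW_dim E \<le> ereal k)"
    (is "_ \<longleftrightarrow> ?R")
proof
  assume le: "hdim TYPE('b) Z \<le> ereal k"
  show ?R
  proof (rule ccontr)
    assume "\<not> ?R"
    have "ereal (of_int (\<lfloor>k\<rfloor> + 1)) \<le> CW_dim E"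
      if "CW_complex X E" "X homotopy_equivalent_space Z" for X :: "'b topology" and E
    proof -
      have "ereal k < CW_dim E" using \<open>\<not> ?R\<close> that by (meson not_le)
      then obtain n where n: "E n \<noteq> {}" "k < real n"
        by (auto simp: CW_dim_def less_SUP_iff)
      then have "\<lfloor>k\<rfloor> < int n" by (simp add: floor_less_iff)
      then have "real_of_int (\<lfloor>k\<rfloor> + 1) \<le> real n" by linarith
      then have "ereal (of_int (\<lfloor>k\<rfloor> + 1)) \<le> ereal (real n)"
        by (simp only: ereal_less_eq)
      also have "\<dots> \<le> CW_dim E"
        unfolding CW_dim_def using n by (intro SUP_upper) auto
      finally show ?thesis .
    qed
    then have "ereal (of_int (\<lfloor>k\<rfloor> + 1)) \<le> hdim TYPE('b) Z"
      unfolding hdim_def by (intro INF_greatest) auto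
    with le have "ereal (of_int (\<lfloor>k\<rfloor> + 1)) \<le> ereal k" by (rule order_trans[rotated])
    then show False by (simp only: ereal_less_eq) linarith
  qed
next
  assume ?R
  then obtain X :: "'b topology" and E where
    *: "CW_complex X E" "X homotopy_equivalent_space Z" "CW_dim E \<le> ereal k" by blast
  then have "hdim TYPE('b) Z \<le> CW_dim E"
    unfolding hdim_def by (intro INF_lower2[of "(X, E)"]) auto
  with * show "hdim TYPE('b) Z \<le> ereal k" by (meson order_trans)
qed

end

theory Submission
  imports Defs "HOL-Homology.Invariance_of_Domain"
begin

text \<open>
  A map \<open>f\<close> from \<open>S\<^sup>M\<close> to \<open>Y\<close> with \<open>f (-x) \<noteq> f x\<close> everywhere gives a map
  \<open>x \<mapsto> (f x, f (-x))\<close> into the ordered pairs of distinct points of \<open>Y\<close> that turns the antipode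
  into the swap.  The proof obstructs such maps without cohomology, with one numerical tool: odd maps
  into \<open>N\<close>-space that avoid the origin.  On the sphere \<open>S\<^sup>M\<close> there is none if \<open>N \<le> M\<close>
  (\<open>Borsuk_Ulam_odd_family\<close>).  On a compact space with a free involution that is assembled from
  pieces of dimension \<open>k < N\<close> there always is one, because it can be constructed piece by piece
  (\<open>odd_extension_over_charts\<close>, \<open>odd_extension_over_stratum\<close>).  So an equivariant map from
  \<open>S\<^sup>M\<close> to such a space is impossible.

  The extension over one piece rests on general position: a Lipschitz map from \<open>k\<close> dimensions into
  \<open>N > k\<close> dimensions misses points arbitrarily close to the origin, so a small perturbation of any
  continuous map avoids the origin (\<open>nonvanishing_modification\<close>).  The same extension result
  deforms an odd self-map of a sphere, through maps of the sphere, to an odd map that preserves the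
  equator; by induction this gives that odd maps have odd degree, and from there the Borsuk-Ulam
  theorem used above.

  For the first claim, the pairs \<open>(f x, f (-x))\<close> form a compact space locally embedded in
  \<open>2d\<close> dimensions, and \<open>N = 2d + 1 \<le> m + 1\<close>.

  For the second claim, a complex \<open>X\<close> of dimension below \<open>N = 2d\<close> is homotopy equivalent to
  the space \<open>D\<close> of unordered pairs.  The sphere maps to \<open>D\<close> and on to a compact part of \<open>X\<close>.
  Pulling the double cover of \<open>D\<close> back along \<open>X \<rightarrow> D\<close> gives a compact space \<open>Z\<close> with a free
  involution, on which an odd map to \<open>N\<close>-space without zeros is built cell by cell
  (\<open>odd_family_over_CW_complex\<close>).  Moving this map back to the sphere requires comparing two
  double covers of \<open>D\<close> along the homotopy from \<open>D \<rightarrow> X \<rightarrow> D\<close> to the identity.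
  Instead of lifting the homotopy, the double cover is replaced by a line field in a finite-dimensional
  vector space, and an odd frame of it is carried along the homotopy by orthogonal projection
  (\<open>line_field_transport\<close>).
\<close>


section \<open>Coordinates and families of real functions\<close>

text \<open>A continuous injection into \<open>k\<close>-space, given by its components.  The dimensions below are
  numbers that vary inside the proofs, so every map into a Euclidean space is written as a family of
  real functions indexed by natural numbers.\<close>

definition real_coordinates :: "'a topology \<Rightarrow> nat \<Rightarrow> (nat \<Rightarrow> 'a \<Rightarrow> real) \<Rightarrow> bool" where
  "real_coordinates X k e \<longleftrightarrow> (\<forall>l<k. continuous_map X euclideanreal (e l)) \<and>
     (\<forall>x\<in>topspace X. \<forall>y\<in>topspace X. (\<forall>l<k. e l x = e l y) \<longrightarrow> x = y)"

lemma real_coordinates_subset: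
  assumes "real_coordinates (subtopology X S) k e" "T \<subseteq> S"
  shows "real_coordinates (subtopology X T) k e"
proof -
  have "continuous_map (subtopology X T) euclideanreal (e l)" if "l < k" for l
    using assms that continuous_map_from_subtopology_mono by (metis real_coordinates_def)
  then show ?thesis using assms unfolding real_coordinates_def by (auto simp: subset_iff)
qed

definition nonvanishing_on :: "nat \<Rightarrow> (nat \<Rightarrow> 'a \<Rightarrow> real) \<Rightarrow> 'a set \<Rightarrow> bool" where
  "nonvanishing_on N \<psi> A \<longleftrightarrow> (\<forall>z\<in>A. \<exists>j<N. \<psi> j z \<noteq> 0)"

lemma nonvanishing_on_Un:
  "nonvanishing_on N \<psi> (A \<union> B) \<longleftrightarrow> nonvanishing_on N \<psi> A \<and> nonvanishing_on N \<psi> B"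
  by (auto simp: nonvanishing_on_def)

lemma nonvanishing_on_subset: "nonvanishing_on N \<psi> A \<Longrightarrow> B \<subseteq> A \<Longrightarrow> nonvanishing_on N \<psi> B"
  by (auto simp: nonvanishing_on_def)

lemma nonvanishing_on_cong:
  assumes "nonvanishing_on N \<psi> A" "\<And>j z. \<lbrakk>j < N; z \<in> A\<rbrakk> \<Longrightarrow> \<psi>' j z = \<psi> j z"
  shows "nonvanishing_on N \<psi>' A"
  using assms unfolding nonvanishing_on_def by (metis (full_types))

lemma nonvanishing_on_iff_sum:
  "nonvanishing_on N \<psi> A \<longleftrightarrow> (\<forall>z\<in>A. 0 < (\<Sum>j<N. \<bar>\<psi> j z\<bar>))"
proof -
  have "(\<exists>j<N. \<psi> j z \<noteq> 0) \<longleftrightarrow> 0 < (\<Sum>j<N. \<bar>\<psi> j z\<bar>)" for z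
  proof -
    have "(\<Sum>j<N. \<bar>\<psi> j z\<bar>) = 0 \<longleftrightarrow> (\<forall>j<N. \<psi> j z = 0)"
      by (subst sum_nonneg_eq_0_iff) auto
    moreover have "0 \<le> (\<Sum>j<N. \<bar>\<psi> j z\<bar>)" by (intro sum_nonneg) auto
    ultimately show ?thesis by (auto simp: order_less_le)
  qed
  then show ?thesis by (simp add: nonvanishing_on_def)
qed


section \<open>Perturbing maps away from the origin\<close>

text \<open>A counting argument.  The source lies in a \<open>k\<close>-dimensional box, which is cut into about
  \<open>M\<^sup>k\<close> cells so small that the image of a cell cannot contain two points of a grid of \<open>M\<^sup>N\<close>
  points in the cube \<open>[0, \<eta>]\<^sup>N\<close>.  For large \<open>M\<close> there are more grid points than cells.\<close>

lemma lipschitz_image_misses_point: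
  fixes e F :: "nat \<Rightarrow> 'a \<Rightarrow> real" and R :: nat
  assumes "k < N" and bounded: "\<And>l x. \<lbrakk>l < k; x \<in> S\<rbrakk> \<Longrightarrow> \<bar>e l x\<bar> \<le> real R"
    and lipschitz: "\<And>j x y. \<lbrakk>j < N; x \<in> S; y \<in> S\<rbrakk>
          \<Longrightarrow> \<bar>F j x - F j y\<bar> \<le> L * (\<Sum>l<k. \<bar>e l x - e l y\<bar>)"
    and "0 \<le> L" "0 < \<eta>"
  obtains c where "\<And>j. j < N \<Longrightarrow> 0 \<le> c j \<and> c j \<le> \<eta>"
    "\<And>x. x \<in> S \<Longrightarrow> \<exists>j<N. F j x \<noteq> c j"
proof -
  obtain C' :: nat where C': "L * real k / \<eta> < real C'"
    using reals_Archimedean2 by blast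
  define C where "C = Suc C'"
  have C: "L * real k < \<eta> * real C"
    using C' \<open>0 < \<eta>\<close> by (simp add: C_def field_simps)
  \<comment> \<open>There are at most \<open>(b * M)\<^sup>k\<close> cells of side \<open>1 / T\<close>, and \<open>M\<close> is chosen so that this is less
    than \<open>M ^ Suc k\<close>; the choice of \<open>C\<close> makes the image of a cell shorter than the mesh \<open>\<eta> / M\<close>.\<close>
  define b where "b = 2 * R * C + 1"
  define M where "M = b ^ k + 1"
  define T where "T = C * M"
  have pos: "0 < M" "0 < C" "0 < T" by (auto simp: M_def C_def T_def)
  define grid where "grid = PiE {..<N} (\<lambda>_. {..<M})"
  define point where "point a j = \<eta> * real (a j) / real M" for a :: "nat \<Rightarrow> nat" and j
  have "\<exists>a\<in>grid. \<forall>x\<in>S. \<exists>j<N. F j x \<noteq> point a j"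
  proof (rule ccontr)
    assume "\<not> ?thesis"
    then have "\<exists>x. x \<in> S \<and> (\<forall>j<N. F j x = point a j)" if "a \<in> grid" for a
      using that by blast
    then obtain X where X: "\<And>a. a \<in> grid \<Longrightarrow> X a \<in> S"
      "\<And>a j. \<lbrakk>a \<in> grid; j < N\<rbrakk> \<Longrightarrow> F j (X a) = point a j"
      by metis
    define cell where "cell a = restrict (\<lambda>l. nat \<lfloor>(e l (X a) + real R) * real T\<rfloor>) {..<k}" for a
    have "cell a \<in> PiE {..<k} (\<lambda>_. {..2 * R * T})" if a: "a \<in> grid" for a
    proof -
      have "nat \<lfloor>(e l (X a) + real R) * real T\<rfloor> \<le> 2 * R * T" if "l < k" for l
      proof -
        have "(e l (X a) + real R) * real T \<le> (2 * real R) * real T"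
          using bounded[OF that X(1)[OF a]] by (intro mult_right_mono) auto
        then have "(e l (X a) + real R) * real T \<le> real (2 * R * T)" by simp
        then show ?thesis by linarith
      qed
      then show ?thesis by (auto simp: cell_def)
    qed
    then have sub: "cell ` grid \<subseteq> PiE {..<k} (\<lambda>_. {..2 * R * T})" by blast
    have "inj_on cell grid"
    proof (rule inj_onI)
      fix a a' assume a: "a \<in> grid" "a' \<in> grid" and eq: "cell a = cell a'"
      have close: "\<bar>e l (X a) - e l (X a')\<bar> \<le> 1 / real T" if "l < k" for l
      proof -
        have "nat \<lfloor>(e l (X a) + real R) * real T\<rfloor> = nat \<lfloor>(e l (X a') + real R) * real T\<rfloor>"
          using fun_cong[OF eq, of l] that by (simp add: cell_def)
        moreover have "0 \<le> (e l (X a) + real R) * real T" "0 \<le> (e l (X a') + real R) * real T"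
          using bounded[OF that X(1)[OF a(1)]] bounded[OF that X(1)[OF a(2)]] by auto
        ultimately have "\<lfloor>(e l (X a) + real R) * real T\<rfloor> = \<lfloor>(e l (X a') + real R) * real T\<rfloor>"
          by (simp add: eq_nat_nat_iff)
        then have "\<bar>(e l (X a) + real R) * real T - (e l (X a') + real R) * real T\<bar> \<le> 1"
          by linarith
        then have "\<bar>e l (X a) - e l (X a')\<bar> * real T \<le> 1"
          using pos by (simp add: abs_mult flip: left_diff_distrib)
        then show ?thesis using pos by (simp add: field_simps)
      qed
      have "a j = a' j" if j: "j < N" for j
      proof (rule ccontr)
        assume ne: "a j \<noteq> a' j"
        have "\<bar>point a j - point a' j\<bar> \<le> L * (\<Sum>l<k. \<bar>e l (X a) - e l (X a')\<bar>)"
          using lipschitz[OF j X(1)[OF a(1)] X(1)[OF a(2)]] X(2) a j by simp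
        also have "\<dots> \<le> L * (\<Sum>l<k. 1 / real T)"
          using close \<open>0 \<le> L\<close> by (intro mult_left_mono sum_mono) auto
        also have "\<dots> = L * real k / (real C * real M)" by (simp add: T_def)
        also have "\<dots> < \<eta> / real M"
          using C pos by (simp add: field_simps)
        finally have "\<bar>point a j - point a' j\<bar> < \<eta> / real M" .
        moreover have "\<bar>point a j - point a' j\<bar> = \<eta> / real M * \<bar>real (a j) - real (a' j)\<bar>"
          using \<open>0 < \<eta>\<close> pos
          by (simp add: point_def abs_mult abs_div flip: diff_divide_distrib right_diff_distrib)
        moreover have "1 \<le> \<bar>real (a j) - real (a' j)\<bar>" using ne by linarith
        moreover have "0 < \<eta> / real M" using \<open>0 < \<eta>\<close> pos by simp
        ultimately show False
          by (metis mult.right_neutral mult_le_cancel_left_pos not_le)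
      qed
      then show "a = a'" using a unfolding grid_def by (intro PiE_ext) auto
    qed
    then have "card grid \<le> card (PiE {..<k} (\<lambda>_. {..2 * R * T}))"
      by (intro card_inj_on_le[OF _ sub] finite_PiE) auto
    then have "M ^ N \<le> (2 * R * T + 1) ^ k"
      by (simp add: grid_def card_PiE)
    also have "\<dots> \<le> (b * M) ^ k"
      using pos by (intro power_mono) (auto simp: b_def T_def algebra_simps)
    also have "\<dots> = b ^ k * M ^ k" by (simp add: power_mult_distrib)
    also have "\<dots> < M * M ^ k" using pos by (simp add: M_def)
    also have "\<dots> = M ^ Suc k" by simp
    also have "\<dots> \<le> M ^ N" using \<open>k < N\<close> pos by (intro power_increasing) auto
    finally show False by simp
  qed
  then obtain a where a: "a \<in> grid" "\<And>x. x \<in> S \<Longrightarrow> \<exists>j<N. F j x \<noteq> point a j"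
    by blast
  show thesis
  proof (rule that[of "point a"])
    show "0 \<le> point a j \<and> point a j \<le> \<eta>" if "j < N" for j
    proof -
      have "a j < M" using a(1) that by (auto simp: grid_def)
      then have "real (a j) / real M \<le> 1" by simp
      then have "\<eta> * (real (a j) / real M) \<le> \<eta> * 1"
        using \<open>0 < \<eta>\<close> by (intro mult_left_mono) auto
      then show ?thesis using \<open>0 < \<eta>\<close> by (simp add: point_def)
    qed
  qed (use a in auto)
qed

lemma compact_positive_lower_bound:
  assumes "compactin X C" "continuous_map X euclideanreal g" "\<And>x. x \<in> C \<Longrightarrow> 0 < g x"
  obtains \<delta> where "0 < \<delta>" "\<And>x. x \<in> C \<Longrightarrow> \<delta> \<le> g x"
proof (cases "C = {}")
  case False
  have "compact (g ` C)"
    using image_compactin[OF assms(1,2)] by simp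
  then obtain m where m: "m \<in> g ` C" "\<And>y. y \<in> g ` C \<Longrightarrow> m \<le> y"
    using compact_attains_inf[of "g ` C"] False by blast
  show thesis
    by (rule that[of m]) (use m assms(3) in auto)
qed (auto intro: that[of 1])

lemma compact_bounded_above:
  assumes "compactin X C" "continuous_map X euclideanreal g"
  obtains B where "0 < B" "\<And>x. x \<in> C \<Longrightarrow> \<bar>g x\<bar> \<le> B"
proof -
  have "bounded (g ` C)"
    using image_compactin[OF assms] by (simp add: compact_imp_bounded)
  then show thesis using that by (auto simp: bounded_pos)
qed

lemma continuous_map_Min:
  assumes "finite A" "A \<noteq> {}" "\<And>y. y \<in> A \<Longrightarrow> continuous_map X euclideanreal (\<lambda>x. f x y)"
  shows "continuous_map X euclideanreal (\<lambda>x. Min (f x ` A))"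
  using assms
proof (induction A rule: finite_ne_induct)
  case (insert a A)
  have "(\<lambda>x. Min (f x ` insert a A)) = (\<lambda>x. min (f x a) (Min (f x ` A)))"
    using insert by auto
  then show ?case using insert by (simp add: continuous_map_real_min)
qed auto

text \<open>The approximation is the infimum of \<open>f y + L * d x y\<close> over \<open>y\<close>, where \<open>d\<close> is the distance
  of the coordinates.  By compactness finitely many \<open>y\<close> suffice, which makes the infimum a minimum
  of continuous functions.\<close>

lemma lipschitz_approximation:
  assumes compact: "compact_space X" and e: "real_coordinates X k e"
    and cont_f: "continuous_map X euclideanreal f" and "0 < \<epsilon>"
  obtains g L where "continuous_map X euclideanreal g" "0 \<le> L"
    "\<And>x y. \<lbrakk>x \<in> topspace X; y \<in> topspace X\<rbrakk>
          \<Longrightarrow> \<bar>g x - g y\<bar> \<le> L * (\<Sum>l<k. \<bar>e l x - e l y\<bar>)"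
    "\<And>x. x \<in> topspace X \<Longrightarrow> \<bar>g x - f x\<bar> \<le> \<epsilon>"
proof (cases "topspace X = {}")
  case True
  show thesis by (rule that[of f 0]) (use True cont_f in auto)
next
  case False
  have cont_e: "continuous_map X euclideanreal (e l)" if "l < k" for l
    using e that by (simp add: real_coordinates_def)
  have separating: "x = y" if "x \<in> topspace X" "y \<in> topspace X" "\<forall>l<k. e l x = e l y" for x y
    using e that by (simp add: real_coordinates_def)
  define d where "d x y = (\<Sum>l<k. \<bar>e l x - e l y\<bar>)" for x y
  have d_nonneg: "0 \<le> d x y" for x y by (simp add: d_def sum_nonneg)
  have d_sym: "d x y = d y x" for x y by (simp add: d_def abs_minus_commute)
  have d_tri: "d x z \<le> d x y + d y z" for x y z
    by (auto simp: d_def simp flip: sum.distrib intro!: sum_mono)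
  have cont_d: "continuous_map X euclideanreal (\<lambda>x. d x y)" for y
    unfolding d_def by (intro continuous_intros cont_e) auto
  have cont_d2: "continuous_map (prod_topology X X) euclideanreal (\<lambda>p. d (fst p) (snd p))"
    unfolding d_def
    by (intro continuous_intros continuous_map_compose[OF continuous_map_fst cont_e, unfolded o_def]
        continuous_map_compose[OF continuous_map_snd cont_e, unfolded o_def]) auto
  have cont_f2: "continuous_map (prod_topology X X) euclideanreal (\<lambda>p. \<bar>f (fst p) - f (snd p)\<bar>)"
    by (intro continuous_intros continuous_map_compose[OF continuous_map_fst cont_f, unfolded o_def]
        continuous_map_compose[OF continuous_map_snd cont_f, unfolded o_def])
  \<comment> \<open>Points between which \<open>f\<close> varies by \<open>\<epsilon>\<close> or more have distance at least some \<open>\<delta> > 0\<close>,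
    so a slope of \<open>2 * B / \<delta>\<close> dominates the oscillation of \<open>f\<close>.\<close>
  define far where "far = {p \<in> topspace (prod_topology X X). \<bar>f (fst p) - f (snd p)\<bar> \<in> {\<epsilon>..}}"
  have "closedin (prod_topology X X) far"
    unfolding far_def by (rule closedin_continuous_map_preimage[OF cont_f2]) auto
  then have "compactin (prod_topology X X) far"
    using compact by (simp add: closedin_compact_space compact_space_prod_topology)
  moreover have "0 < d (fst p) (snd p)" if "p \<in> far" for p
  proof -
    have "fst p \<in> topspace X" "snd p \<in> topspace X" "fst p \<noteq> snd p"
      using that \<open>0 < \<epsilon>\<close> by (auto simp: far_def)
    then obtain l where l: "l < k" "e l (fst p) \<noteq> e l (snd p)" using separating by blast
    then have "0 < \<bar>e l (fst p) - e l (snd p)\<bar>" by simp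
    also have "\<dots> \<le> d (fst p) (snd p)"
      unfolding d_def using l by (intro member_le_sum) auto
    finally show ?thesis .
  qed
  ultimately obtain \<delta> where \<delta>: "0 < \<delta>" "\<And>p. p \<in> far \<Longrightarrow> \<delta> \<le> d (fst p) (snd p)"
    using compact_positive_lower_bound[OF _ cont_d2] by blast
  obtain B where B: "0 < B" "\<And>x. x \<in> topspace X \<Longrightarrow> \<bar>f x\<bar> \<le> B"
    using compact_bounded_above[OF _ cont_f] compact by (auto simp: compact_space_def)
  define L where "L = 2 * B / \<delta>"
  have "0 \<le> L" using \<delta> B by (simp add: L_def)
  have mod: "f x \<le> f y + L * d x y + \<epsilon>" if "x \<in> topspace X" "y \<in> topspace X" for x y
  proof (cases "(x, y) \<in> far")
    case True
    have "2 * B = L * \<delta>" using \<delta> by (simp add: L_def)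
    also have "\<dots> \<le> L * d x y" using \<delta>(2)[OF True] \<open>0 \<le> L\<close> by (intro mult_left_mono) auto
    finally show ?thesis using B(2)[OF that(1)] B(2)[OF that(2)] \<open>0 < \<epsilon>\<close> by linarith
  next
    case False
    then have "\<bar>f x - f y\<bar> < \<epsilon>" using that by (auto simp: far_def)
    moreover have "0 \<le> L * d x y" using \<open>0 \<le> L\<close> d_nonneg by simp
    ultimately show ?thesis by linarith
  qed
  define W where "W y = {x \<in> topspace X. f y + L * d x y - f x \<in> {..<\<epsilon>}}" for y
  have openW: "openin X (W y)" for y
    unfolding W_def
    by (rule openin_continuous_map_preimage[where Y = euclideanreal])
       (auto intro!: continuous_intros cont_f cont_d)
  have "y \<in> W y" if "y \<in> topspace X" for y
    using that \<open>0 < \<epsilon>\<close> by (simp add: W_def d_def)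
  then have "topspace X \<subseteq> \<Union>(W ` topspace X)" by blast
  then obtain \<F> where \<F>: "finite \<F>" "\<F> \<subseteq> W ` topspace X" "topspace X \<subseteq> \<Union>\<F>"
    using compact openW unfolding compact_space_alt by (metis (no_types, lifting) image_iff)
  then obtain A where A: "finite A" "A \<subseteq> topspace X" "\<F> = W ` A"
    by (metis finite_subset_image)
  then have "A \<noteq> {}" using \<F> False by auto
  define g where "g x = Min ((\<lambda>y. f y + L * d x y) ` A)" for x
  have g_le: "g x \<le> f y + L * d x y" if "y \<in> A" for x y
    using that A by (simp add: g_def)
  have g_eq: "\<exists>y\<in>A. g x = f y + L * d x y" for x
  proof -
    have "g x \<in> (\<lambda>y. f y + L * d x y) ` A"
      unfolding g_def by (rule Min_in) (use A \<open>A \<noteq> {}\<close> in auto)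
    then show ?thesis by blast
  qed
  have half: "g x \<le> g y + L * d x y" for x y
  proof -
    obtain z where z: "z \<in> A" "g y = f z + L * d y z" using g_eq by blast
    have "g x \<le> f z + L * d x z" using g_le z by blast
    also have "\<dots> \<le> f z + L * (d x y + d y z)"
      using d_tri \<open>0 \<le> L\<close> by (intro add_left_mono mult_left_mono) auto
    finally show ?thesis using z by (simp add: algebra_simps)
  qed
  show thesis
  proof (rule that[of g L])
    show "continuous_map X euclideanreal g"
      unfolding g_def using A \<open>A \<noteq> {}\<close>
      by (intro continuous_map_Min continuous_intros cont_d) auto
    show "\<bar>g x - g y\<bar> \<le> L * (\<Sum>l<k. \<bar>e l x - e l y\<bar>)" for x y
      using half[of x y] half[of y x] d_sym[of x y] by (simp add: d_def)
    show "\<bar>g x - f x\<bar> \<le> \<epsilon>" if x: "x \<in> topspace X" for x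
    proof -
      obtain y where "y \<in> A" "x \<in> W y" using x \<F> A by auto
      then have "g x \<le> f x + \<epsilon>" using g_le[of y x] by (simp add: W_def)
      moreover obtain z where z: "z \<in> A" "g x = f z + L * d x z" using g_eq by blast
      ultimately show ?thesis using mod[of x z] x A by auto
    qed
  qed (use \<open>0 \<le> L\<close> in auto)
qed

text \<open>General position: in a space of dimension \<open>k < N\<close> the zeros of \<open>g\<close> can be removed without
  changing \<open>g\<close> on a closed set \<open>B\<close> free of zeros.  A Lipschitz approximation of \<open>g\<close>, shifted by a
  small vector that it does not attain, is a nowhere vanishing family \<open>h\<close> with \<open>g - h\<close> of norm at
  most \<open>\<rho>\<close>.  Stretching \<open>h\<close> to norm at least \<open>2 * \<rho>\<close> does nothing on \<open>B\<close>, where \<open>h\<close> is already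
  that long; adding \<open>g - h\<close> afterwards restores \<open>g\<close> on \<open>B\<close> and cannot produce a zero.\<close>

lemma nonvanishing_modification:
  assumes compact: "compact_space X" and Haus: "Hausdorff_space X"
    and e: "real_coordinates X k e" and "k < N"
    and B: "closedin X B" "nonvanishing_on N g B"
    and cont_g: "\<And>j. j < N \<Longrightarrow> continuous_map X euclideanreal (g j)"
  obtains G where "\<And>j. j < N \<Longrightarrow> continuous_map X euclideanreal (G j)"
    "\<And>j x. \<lbrakk>j < N; x \<in> B\<rbrakk> \<Longrightarrow> G j x = g j x" "nonvanishing_on N G (topspace X)"
proof -
  have cont_e: "continuous_map X euclideanreal (e l)" if "l < k" for l
    using e that by (simp add: real_coordinates_def)
  have cpt: "compactin X (topspace X)" using compact by (simp add: compact_space_def)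
  define nrm where "nrm f x = (\<Sum>j<N. \<bar>f j x\<bar>)" for f :: "nat \<Rightarrow> 'a \<Rightarrow> real" and x
  have cont_nrm: "continuous_map X euclideanreal (nrm f)"
    if "\<And>j. j < N \<Longrightarrow> continuous_map X euclideanreal (f j)" for f
    unfolding nrm_def using that by (intro continuous_intros) auto
  have nrm_tri: "nrm f x \<le> nrm f' x + nrm f'' x"
    if "\<And>j. j < N \<Longrightarrow> f j x = f' j x + f'' j x" for f f' f'' x
    unfolding nrm_def sum.distrib[symmetric] using that by (intro sum_mono) (auto simp: abs_triangle_ineq)
  have "compactin X B" using B(1) compact closedin_compact_space by blast
  then obtain \<rho>' where \<rho>': "0 < \<rho>'" "\<And>x. x \<in> B \<Longrightarrow> \<rho>' \<le> nrm g x"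
    using compact_positive_lower_bound[OF _ cont_nrm[of g, OF cont_g]] B(2)
    unfolding nonvanishing_on_iff_sum nrm_def by metis
  define \<rho> where "\<rho> = \<rho>' / 4"
  define \<eta> where "\<eta> = \<rho> / (2 * real N)"
  have pos: "0 < \<rho>" "0 < \<eta>" and N\<eta>: "real N * (2 * \<eta>) = \<rho>"
    using \<rho>' \<open>k < N\<close> by (auto simp: \<rho>_def \<eta>_def)
  define approx where "approx j f L \<longleftrightarrow> continuous_map X euclideanreal f \<and> 0 \<le> L \<and>
      (\<forall>x\<in>topspace X. \<forall>y\<in>topspace X. \<bar>f x - f y\<bar> \<le> L * (\<Sum>l<k. \<bar>e l x - e l y\<bar>)) \<and>
      (\<forall>x\<in>topspace X. \<bar>f x - g j x\<bar> \<le> \<eta>)" for j f and L :: real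
  have "\<exists>f L. approx j f L" if j: "j < N" for j
  proof -
    obtain f L where "continuous_map X euclideanreal f" "0 \<le> L"
      "\<And>x y. \<lbrakk>x \<in> topspace X; y \<in> topspace X\<rbrakk> \<Longrightarrow> \<bar>f x - f y\<bar> \<le> L * (\<Sum>l<k. \<bar>e l x - e l y\<bar>)"
      "\<And>x. x \<in> topspace X \<Longrightarrow> \<bar>f x - g j x\<bar> \<le> \<eta>"
      by (rule lipschitz_approximation[OF compact e cont_g[OF j] pos(2)])
        (assumption | rule that)+
    then show ?thesis unfolding approx_def by blast
  qed
  then obtain F L where approx: "\<And>j. j < N \<Longrightarrow> approx j (F j) (L j)" by metis
  have F: "continuous_map X euclideanreal (F j)" "0 \<le> L j"
      "\<And>x y. \<lbrakk>x \<in> topspace X; y \<in> topspace X\<rbrakk>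
        \<Longrightarrow> \<bar>F j x - F j y\<bar> \<le> L j * (\<Sum>l<k. \<bar>e l x - e l y\<bar>)"
      "\<And>x. x \<in> topspace X \<Longrightarrow> \<bar>F j x - g j x\<bar> \<le> \<eta>" if "j < N" for j
    using approx[OF that] by (auto simp: approx_def)
  define L' where "L' = (\<Sum>j<N. L j)"
  have L': "0 \<le> L'" "\<And>j. j < N \<Longrightarrow> L j \<le> L'"
    using F(2) unfolding L'_def by (auto intro!: sum_nonneg member_le_sum)
  have lip: "\<bar>F j x - F j y\<bar> \<le> L' * (\<Sum>l<k. \<bar>e l x - e l y\<bar>)"
    if "j < N" "x \<in> topspace X" "y \<in> topspace X" for j x y
    using F(3)[OF that] mult_right_mono[OF L'(2)[OF that(1)], of "\<Sum>l<k. \<bar>e l x - e l y\<bar>"]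
    by (simp add: sum_nonneg)
  have "\<exists>b. \<forall>x\<in>topspace X. \<bar>e l x\<bar> \<le> b" if l: "l < k" for l
    by (rule compact_bounded_above[OF cpt cont_e[OF l]]) auto
  then obtain B' where "\<forall>l\<in>{..<k}. \<forall>x\<in>topspace X. \<bar>e l x\<bar> \<le> B' l"
    using bchoice[of "{..<k}" "\<lambda>l b. \<forall>x\<in>topspace X. \<bar>e l x\<bar> \<le> b"] by auto
  then have B': "\<bar>e l x\<bar> \<le> B' l" if "l < k" "x \<in> topspace X" for l x using that by auto
  obtain R :: nat where R: "(\<Sum>l<k. \<bar>B' l\<bar>) \<le> real R" using real_arch_simple by blast
  have bdd: "\<bar>e l x\<bar> \<le> real R" if "l < k" "x \<in> topspace X" for l x
  proof -
    have "\<bar>B' l\<bar> \<le> (\<Sum>l<k. \<bar>B' l\<bar>)"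
      using that by (intro member_le_sum[where f = "\<lambda>l. \<bar>B' l\<bar>"]) auto
    then show ?thesis using B'[OF that] R by linarith
  qed
  obtain c where c: "\<And>j. j < N \<Longrightarrow> 0 \<le> c j \<and> c j \<le> \<eta>"
    "\<And>x. x \<in> topspace X \<Longrightarrow> \<exists>j<N. F j x \<noteq> c j"
    by (rule lipschitz_image_misses_point[OF \<open>k < N\<close> bdd lip L'(1) pos(2)])
      (assumption | rule that)+
  define h where "h j x = F j x - c j" for j x
  have cont_h: "continuous_map X euclideanreal (h j)" if "j < N" for j
    unfolding h_def using that F by (intro continuous_intros) auto
  have h_pos: "0 < nrm h x" if "x \<in> topspace X" for x
  proof -
    have "nonvanishing_on N h (topspace X)"
      using c(2) by (auto simp: nonvanishing_on_def h_def)
    then show ?thesis using that by (simp add: nonvanishing_on_iff_sum nrm_def)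
  qed
  define D where "D j x = g j x - h j x" for j x
  have D: "nrm D x \<le> \<rho>" if "x \<in> topspace X" for x
  proof -
    have "nrm D x \<le> (\<Sum>j<N. 2 * \<eta>)"
      unfolding nrm_def
    proof (intro sum_mono)
      fix j assume "j \<in> {..<N}"
      then have "j < N" by simp
      then show "\<bar>D j x\<bar> \<le> 2 * \<eta>"
        using F(4)[OF _ that, of j] c(1)[of j] by (simp add: D_def h_def abs_le_iff)
    qed
    then show ?thesis using N\<eta> by simp
  qed
  define s where "s x = max 1 (2 * \<rho> / nrm h x)" for x
  define G where "G j x = s x * h j x + D j x" for j x
  show thesis
  proof (rule that[of G])
    show "continuous_map X euclideanreal (G j)" if "j < N" for j
    proof -
      have "continuous_map X euclideanreal s"
        unfolding s_def using order_less_imp_not_eq2[OF h_pos]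
        by (intro continuous_intros cont_nrm cont_h) auto
      then show ?thesis
        unfolding G_def D_def using that
        by (intro continuous_intros cont_h cont_g) auto
    qed
    show "G j x = g j x" if "j < N" "x \<in> B" for j x
    proof -
      have x: "x \<in> topspace X" using B(1) that closedin_subset by blast
      have "nrm g x \<le> nrm h x + nrm D x" by (rule nrm_tri) (simp add: D_def)
      then have "2 * \<rho> \<le> nrm h x" using \<rho>'(2)[OF that(2)] D[OF x] pos by (simp add: \<rho>_def)
      then have "s x = 1" using h_pos[OF x] by (simp add: s_def field_simps)
      then show ?thesis by (simp add: G_def D_def)
    qed
    show "nonvanishing_on N G (topspace X)"
      unfolding nonvanishing_on_iff_sum
    proof
      fix x assume x: "x \<in> topspace X"
      have "2 * \<rho> \<le> s x * nrm h x"
        using h_pos[OF x] by (simp add: s_def max_mult_distrib_right)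
      also have "\<dots> = nrm (\<lambda>j x. s x * h j x) x"
        by (simp add: nrm_def abs_mult sum_distrib_left s_def)
      also have "\<dots> \<le> nrm G x + nrm (\<lambda>j x. - D j x) x"
        by (rule nrm_tri) (simp add: G_def)
      also have "nrm (\<lambda>j x. - D j x) x = nrm D x" by (simp add: nrm_def)
      finally show "0 < (\<Sum>j<N. \<bar>G j x\<bar>)" using D[OF x] pos by (simp add: nrm_def)
    qed
  qed
qed

lemma continuous_extension_vanishing_on:
  assumes "normal_space Z" "closedin Z A" "closedin Z K"
    and "continuous_map (subtopology Z K) euclideanreal \<delta>" "\<And>z. z \<in> A \<inter> K \<Longrightarrow> \<delta> z = 0"
  obtains \<Delta> where "continuous_map Z euclideanreal \<Delta>" "\<And>z. z \<in> K \<Longrightarrow> \<Delta> z = \<delta> z"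
    "\<And>z. z \<in> A \<Longrightarrow> \<Delta> z = 0"
proof -
  define T where "T b = (if b then K else A)" for b
  define f where "f b = (if b then \<delta> else (\<lambda>_. 0))" for b
  let ?X = "subtopology Z (A \<union> K)"
  have "closedin ?X (T b)" for b
    using assms by (auto simp: T_def intro: closedin_subset_topspace)
  moreover have "continuous_map (subtopology ?X (T b)) euclideanreal (f b)" for b
  proof (cases b)
    case True
    moreover have "(A \<union> K) \<inter> K = K" by blast
    ultimately show ?thesis using assms(4) by (simp add: subtopology_subtopology T_def f_def)
  next
    case False
    have "f b = (\<lambda>_. 0)" using False by (simp add: f_def)
    then show ?thesis by (metis continuous_map_canonical_const)
  qed
  moreover have "f b x = f b' x" if "x \<in> topspace ?X \<inter> T b \<inter> T b'" for b b' x
    using that assms(5) by (auto simp: T_def f_def split: if_splits)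
  moreover have "\<exists>b. b \<in> UNIV \<and> x \<in> T b \<and> (if x \<in> K then \<delta> x else 0) = f b x"
    if "x \<in> topspace ?X" for x
    using that by (intro exI[of _ "x \<in> K"]) (auto simp: T_def f_def)
  ultimately have cont: "continuous_map ?X euclideanreal (\<lambda>x. if x \<in> K then \<delta> x else 0)"
    using pasting_lemma_closed[of UNIV ?X T euclideanreal f "\<lambda>x. if x \<in> K then \<delta> x else 0"] by simp
  obtain \<Delta> where "continuous_map Z euclideanreal \<Delta>"
    "\<And>z. z \<in> A \<union> K \<Longrightarrow> \<Delta> z = (if z \<in> K then \<delta> z else 0)"
    using Tietze_extension_realinterval[OF assms(1) closedin_Un[OF assms(2,3)] is_interval_univ _ cont]
    by auto
  with assms(5) show thesis by (intro that[of \<Delta>]) auto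
qed


section \<open>Odd maps on compact spaces with a free involution\<close>

definition odd_family :: "'a topology \<Rightarrow> ('a \<Rightarrow> 'a) \<Rightarrow> nat \<Rightarrow> (nat \<Rightarrow> 'a \<Rightarrow> real) \<Rightarrow> bool" where
  "odd_family Z \<sigma> N \<psi> \<longleftrightarrow> (\<forall>j<N. continuous_map Z euclideanreal (\<psi> j) \<and>
     (\<forall>z\<in>topspace Z. \<psi> j (\<sigma> z) = - \<psi> j z))"

locale compact_free_involution =
  fixes Z :: "'a topology" and \<sigma> :: "'a \<Rightarrow> 'a"
  assumes compact_Z: "compact_space Z" and Hausdorff_Z: "Hausdorff_space Z"
    and free: "free_involution Z \<sigma>"
begin

lemma normal_Z: "normal_space Z"
  using compact_Z Hausdorff_Z compact_Hausdorff_or_regular_imp_normal_space by blast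

lemma cont_\<sigma>: "continuous_map Z Z \<sigma>"
  using free by (simp add: free_involution_def)

lemma \<sigma>_simps [simp]: "z \<in> topspace Z \<Longrightarrow> \<sigma> (\<sigma> z) = z" "z \<in> topspace Z \<Longrightarrow> \<sigma> z \<noteq> z"
    "z \<in> topspace Z \<Longrightarrow> \<sigma> z \<in> topspace Z"
  using free continuous_map_image_subset_topspace[OF cont_\<sigma>] by (auto simp: free_involution_def)

lemma closed_\<sigma>_image: "closedin Z K \<Longrightarrow> closedin Z (\<sigma> ` K)"
  by (meson Hausdorff_Z closedin_compact_space compactin_imp_closedin compact_Z cont_\<sigma> image_compactin)

lemma continuous_map_\<sigma>: "continuous_map Z Y f \<Longrightarrow> continuous_map Z Y (\<lambda>z. f (\<sigma> z))"
  using continuous_map_compose[OF cont_\<sigma>] by (simp add: o_def)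

text \<open>On a closed set \<open>K\<close> disjoint from its mirror image, oddness imposes no condition: the values
  there can be chosen by general position, and those on the mirror image follow.\<close>

lemma odd_extension_over_half:
  assumes A: "closedin Z A" "\<sigma> ` A \<subseteq> A" "odd_family Z \<sigma> N \<psi>" "nonvanishing_on N \<psi> A"
    and K: "closedin Z K" "K \<inter> \<sigma> ` K = {}" "real_coordinates (subtopology Z K) k e" and "k < N"
  obtains \<psi>' where "odd_family Z \<sigma> N \<psi>'" "\<And>j z. \<lbrakk>j < N; z \<in> A\<rbrakk> \<Longrightarrow> \<psi>' j z = \<psi> j z"
    "nonvanishing_on N \<psi>' (A \<union> (K \<union> \<sigma> ` K))"
proof -
  have AZ: "A \<subseteq> topspace Z" and KZ: "K \<subseteq> topspace Z" using closedin_subset[OF A(1)] closedin_subset[OF K(1)] by auto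
  have \<psi>: "continuous_map Z euclideanreal (\<psi> j)" "\<And>z. z \<in> topspace Z \<Longrightarrow> \<psi> j (\<sigma> z) = - \<psi> j z"
    if "j < N" for j using A(3) that by (auto simp: odd_family_def)
  have topK: "topspace (subtopology Z K) = K" using KZ by auto
  have \<psi>K: "continuous_map (subtopology Z K) euclideanreal (\<psi> j)" if "j < N" for j
    using \<psi>(1)[OF that] by (rule continuous_map_from_subtopology)
  have "compact_space (subtopology Z K)"
    using K(1) compact_Z closedin_compact_space compact_space_subtopology by blast
  moreover have "Hausdorff_space (subtopology Z K)"
    using Hausdorff_Z by (rule Hausdorff_space_subtopology)
  moreover have "closedin (subtopology Z K) (A \<inter> K)"
    using A(1) by (auto simp: closedin_subtopology)
  moreover have "nonvanishing_on N \<psi> (A \<inter> K)" using A(4) by (simp add: nonvanishing_on_def)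
  ultimately obtain G where G: "\<And>j. j < N \<Longrightarrow> continuous_map (subtopology Z K) euclideanreal (G j)"
    "\<And>j x. \<lbrakk>j < N; x \<in> A \<inter> K\<rbrakk> \<Longrightarrow> G j x = \<psi> j x" "nonvanishing_on N G K"
    using nonvanishing_modification[of "subtopology Z K" k e N "A \<inter> K" \<psi>, OF _ _ K(3) \<open>k < N\<close> _ _ \<psi>K]
    unfolding topK by blast
  have "\<exists>\<Delta>. continuous_map Z euclideanreal \<Delta> \<and> (\<forall>z\<in>K. \<Delta> z = G j z - \<psi> j z) \<and> (\<forall>z\<in>A. \<Delta> z = 0)"
    if "j < N" for j
  proof -
    have "continuous_map (subtopology Z K) euclideanreal (\<lambda>z. G j z - \<psi> j z)"
      by (intro continuous_map_diff G(1) \<psi>K that)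
    moreover have "G j z - \<psi> j z = 0" if "z \<in> A \<inter> K" for z using G(2)[OF \<open>j < N\<close> that] by simp
    ultimately obtain \<Delta> where "continuous_map Z euclideanreal \<Delta>"
      "\<And>z. z \<in> K \<Longrightarrow> \<Delta> z = G j z - \<psi> j z" "\<And>z. z \<in> A \<Longrightarrow> \<Delta> z = 0"
      using continuous_extension_vanishing_on[OF normal_Z A(1) K(1), of "\<lambda>z. G j z - \<psi> j z"] by blast
    then show ?thesis by blast
  qed
  then obtain \<Delta> where \<Delta>: "\<And>j. j < N \<Longrightarrow> continuous_map Z euclideanreal (\<Delta> j)"
    "\<And>j z. \<lbrakk>j < N; z \<in> K\<rbrakk> \<Longrightarrow> \<Delta> j z = G j z - \<psi> j z" "\<And>j z. \<lbrakk>j < N; z \<in> A\<rbrakk> \<Longrightarrow> \<Delta> j z = 0"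
    by metis
  obtain \<theta> where \<theta>: "continuous_map Z euclideanreal \<theta>" "\<theta> ` (\<sigma> ` K) \<subseteq> {0}" "\<theta> ` K \<subseteq> {1}"
    using Urysohn_lemma_alt[OF normal_Z closed_\<sigma>_image[OF K(1)] K(1)] K(2)
    by (metis disjnt_def inf_commute)
  \<comment> \<open>The cut-off \<open>\<theta>\<close> separates \<open>K\<close> from its mirror image, so antisymmetrising the cut-off
    correction leaves it unchanged on \<open>K\<close>.\<close>
  define \<psi>' where "\<psi>' j z = \<psi> j z + (\<theta> z * \<Delta> j z - \<theta> (\<sigma> z) * \<Delta> j (\<sigma> z))" for j z
  have odd: "odd_family Z \<sigma> N \<psi>'"
    unfolding odd_family_def \<psi>'_def using \<psi> \<theta> \<Delta>
    by (auto intro!: continuous_intros continuous_map_\<sigma>)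
  have eqA: "\<psi>' j z = \<psi> j z" if "j < N" "z \<in> A" for j z
    using that \<Delta>(3)[OF that] \<Delta>(3)[OF that(1), of "\<sigma> z"] A(2) by (auto simp: \<psi>'_def)
  have eqK: "\<psi>' j z = G j z" if "j < N" "z \<in> K" for j z
  proof -
    have "\<theta> z = 1" "\<theta> (\<sigma> z) = 0" using that \<theta>(2,3) by auto
    then show ?thesis using \<Delta>(2)[OF that] by (simp add: \<psi>'_def)
  qed
  have nvK: "nonvanishing_on N \<psi>' K"
    using G(3) eqK by (rule nonvanishing_on_cong)
  show thesis
  proof (rule that[OF odd eqA])
    have "\<exists>j<N. \<psi>' j (\<sigma> z) \<noteq> 0" if "z \<in> K" for z
      using nvK odd that KZ by (fastforce simp: nonvanishing_on_def odd_family_def)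
    then have "nonvanishing_on N \<psi>' (\<sigma> ` K)" by (auto simp: nonvanishing_on_def)
    then show "nonvanishing_on N \<psi>' (A \<union> (K \<union> \<sigma> ` K))"
      using nonvanishing_on_cong[OF A(4) eqA] nvK by (simp add: nonvanishing_on_Un)
  qed
qed

text \<open>Compactness reduces this to finitely many applications of the previous lemma.  That the old family
  is kept exactly on \<open>A\<close> makes the straight-line homotopy from the old to the new family constant
  there, which the proof of the Borsuk-Ulam theorem exploits.\<close>

lemma odd_extension_over_charts:
  assumes A: "closedin Z A" "\<sigma> ` A \<subseteq> A" "odd_family Z \<sigma> N \<psi>" "nonvanishing_on N \<psi> A"
    and C: "closedin Z C" and "k < N"
    and charts: "\<And>z. z \<in> C \<Longrightarrow> \<exists>W e. openin Z W \<and> z \<in> W \<and> W \<inter> \<sigma> ` W = {} \<and>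
                    real_coordinates (subtopology Z (W \<inter> C)) k e"
  obtains \<psi>' where "odd_family Z \<sigma> N \<psi>'" "\<And>j z. \<lbrakk>j < N; z \<in> A\<rbrakk> \<Longrightarrow> \<psi>' j z = \<psi> j z"
    "nonvanishing_on N \<psi>' (A \<union> C)"
proof -
  have AZ: "A \<subseteq> topspace Z" and CZ: "C \<subseteq> topspace Z" using closedin_subset[OF A(1)] closedin_subset[OF C] by auto
  define half where "half z V K \<longleftrightarrow> openin Z V \<and> z \<in> V \<and> V \<inter> C \<subseteq> K \<and> closedin Z K \<and>
      K \<inter> \<sigma> ` K = {} \<and> (\<exists>e. real_coordinates (subtopology Z K) k e)" for z V K
  have "\<exists>V K. half z V K" if z: "z \<in> C" for z
  proof -
    obtain W e where W: "openin Z W" "z \<in> W" "W \<inter> \<sigma> ` W = {}"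
      "real_coordinates (subtopology Z (W \<inter> C)) k e"
      using charts[OF z] by blast
    have "regular_space Z"
      using compact_Z Hausdorff_Z compact_Hausdorff_imp_regular_space by blast
    then obtain V K where VK: "openin Z V" "closedin Z K" "z \<in> V" "V \<subseteq> K" "K \<subseteq> W"
      using W unfolding neighbourhood_base_of_closedin[symmetric] neighbourhood_base_of by metis
    have "closedin Z (K \<inter> C)" using VK C by blast
    moreover have "(K \<inter> C) \<inter> \<sigma> ` (K \<inter> C) = {}" using W(3) VK by blast
    moreover have "real_coordinates (subtopology Z (K \<inter> C)) k e"
      using W(4) by (rule real_coordinates_subset) (use VK in blast)
    moreover have "V \<inter> C \<subseteq> K \<inter> C" using VK by blast
    ultimately show ?thesis using VK(1,3) 
      unfolding half_def by (intro exI[of _ V] exI[of _ "K \<inter> C"]) auto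
  qed
  then obtain V K where half: "\<And>z. z \<in> C \<Longrightarrow> half z (V z) (K z)" by metis
  have VK: "openin Z (V z)" "z \<in> V z" "V z \<inter> C \<subseteq> K z" "closedin Z (K z)"
    "K z \<inter> \<sigma> ` K z = {}" "\<exists>e. real_coordinates (subtopology Z (K z)) k e" if "z \<in> C" for z
    using half[OF that] by (auto simp: half_def)
  have "compactin Z C" using C compact_Z closedin_compact_space by blast
  moreover have "C \<subseteq> \<Union>(V ` C)" using VK by blast
  ultimately obtain \<F> where "finite \<F>" "\<F> \<subseteq> V ` C" "C \<subseteq> \<Union>\<F>"
    using VK(1) unfolding compactin_def by (metis (no_types, lifting) imageE)
  then obtain P where P: "finite P" "P \<subseteq> C" "C \<subseteq> \<Union>(V ` P)"
    by (metis finite_subset_image)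
  have "\<exists>\<psi>'. odd_family Z \<sigma> N \<psi>' \<and> (\<forall>j<N. \<forall>z\<in>A. \<psi>' j z = \<psi> j z) \<and>
      nonvanishing_on N \<psi>' (A \<union> (\<Union>p\<in>P. K p \<union> \<sigma> ` K p))"
    using P(1,2)
  proof (induction P rule: finite_induct)
    case empty
    then show ?case using A by auto
  next
    case (insert p P)
    let ?A = "A \<union> (\<Union>p\<in>P. K p \<union> \<sigma> ` K p)"
    from insert obtain \<psi>' where \<psi>': "odd_family Z \<sigma> N \<psi>'" "\<forall>j<N. \<forall>z\<in>A. \<psi>' j z = \<psi> j z"
      "nonvanishing_on N \<psi>' ?A" by auto
    have p: "p \<in> C" and PC: "P \<subseteq> C" using insert by auto
    have clA: "closedin Z ?A"
      using A(1) insert.hyps(1) PC VK(4)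
      by (intro closedin_Un closedin_Union) (auto intro!: closed_\<sigma>_image)
    have invA: "\<sigma> ` ?A \<subseteq> ?A"
    proof -
      have "\<sigma> (\<sigma> z) = z" if "z \<in> K q" "q \<in> P" for z q
        using that PC VK(4) by (meson \<sigma>_simps(1) closedin_subset subsetD)
      then show ?thesis using A(2) by fastforce
    qed
    obtain e where e: "real_coordinates (subtopology Z (K p)) k e" using VK(6)[OF p] by blast
    obtain \<psi>'' where \<psi>'': "odd_family Z \<sigma> N \<psi>''"
      "\<And>j z. \<lbrakk>j < N; z \<in> ?A\<rbrakk> \<Longrightarrow> \<psi>'' j z = \<psi>' j z"
      "nonvanishing_on N \<psi>'' (?A \<union> (K p \<union> \<sigma> ` K p))"
      by (rule odd_extension_over_half[OF clA invA \<psi>'(1,3) VK(4)[OF p] VK(5)[OF p] e \<open>k < N\<close>])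
        (rule that; assumption)
    have eq: "?A \<union> (K p \<union> \<sigma> ` K p) = A \<union> (\<Union>p\<in>insert p P. K p \<union> \<sigma> ` K p)" by auto
    have "\<forall>j<N. \<forall>z\<in>A. \<psi>'' j z = \<psi> j z" using \<psi>'(2) \<psi>''(2) by auto
    then show ?case using \<psi>''(1) \<psi>''(3)[unfolded eq] by (intro exI[of _ \<psi>''] conjI)
  qed
  then obtain \<psi>' where \<psi>': "odd_family Z \<sigma> N \<psi>'" "\<forall>j<N. \<forall>z\<in>A. \<psi>' j z = \<psi> j z"
    "nonvanishing_on N \<psi>' (A \<union> (\<Union>p\<in>P. K p \<union> \<sigma> ` K p))" by blast
  have "C \<subseteq> (\<Union>p\<in>P. K p \<union> \<sigma> ` K p)"
  proof
    fix z assume z: "z \<in> C"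
    then obtain p where p: "p \<in> P" "z \<in> V p" using P(3) by auto
    then have "z \<in> K p" using VK(3)[of p] P(2) z by auto
    then show "z \<in> (\<Union>p\<in>P. K p \<union> \<sigma> ` K p)" using p by auto
  qed
  then have "nonvanishing_on N \<psi>' (A \<union> C)"
    by (intro nonvanishing_on_subset[OF \<psi>'(3)]) blast
  with \<psi>' show thesis by (intro that[of \<psi>']) auto
qed

text \<open>The stratum \<open>E\<close>, typically the part of \<open>Z\<close> over an open cell, need not be closed, and its
  coordinates need only be injective up to \<open>\<sigma>\<close>.  A family without zeros on \<open>A\<close> has none near \<open>A\<close>
  either, and what remains of \<open>A \<union> E\<close> is a compact part of \<open>E\<close>, to which charts apply: a set
  disjoint from its mirror image contains no two points exchanged by \<open>\<sigma>\<close>.\<close>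

lemma odd_extension_over_stratum:
  assumes A: "closedin Z A" "\<sigma> ` A \<subseteq> A" "odd_family Z \<sigma> N \<psi>" "nonvanishing_on N \<psi> A"
    and E: "closedin Z (A \<union> E)" "\<sigma> ` E \<subseteq> E" and "k < N"
    and cont_e: "\<And>l. l < k \<Longrightarrow> continuous_map (subtopology Z E) euclideanreal (e l)"
    and sep: "\<And>z z'. \<lbrakk>z \<in> E; z' \<in> E; \<forall>l<k. e l z = e l z'\<rbrakk> \<Longrightarrow> z' = z \<or> z' = \<sigma> z"
  obtains \<psi>' where "odd_family Z \<sigma> N \<psi>'" "nonvanishing_on N \<psi>' (A \<union> E)"
proof -
  define nrm where "nrm z = (\<Sum>j<N. \<bar>\<psi> j z\<bar>)" for z
  have AEZ: "A \<union> E \<subseteq> topspace Z" using E(1) closedin_subset by blast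
  have cont_nrm: "continuous_map Z euclideanreal nrm"
    unfolding nrm_def using A(3) by (intro continuous_intros) (auto simp: odd_family_def)
  have nrm_\<sigma>: "nrm (\<sigma> z) = nrm z" if "z \<in> topspace Z" for z
    unfolding nrm_def using A(3) that by (auto simp: odd_family_def intro!: sum.cong)
  have "compactin Z A" using A(1) compact_Z closedin_compact_space by blast
  then obtain \<rho> where \<rho>: "0 < \<rho>" "\<And>z. z \<in> A \<Longrightarrow> \<rho> \<le> nrm z"
    using compact_positive_lower_bound[OF _ cont_nrm] A(4)
    by (auto simp: nonvanishing_on_iff_sum nrm_def)
  \<comment> \<open>\<open>A'\<close> and \<open>C\<close> are the parts where the family is bounded away from zero and where it is small;
    as its norm is at least \<open>\<rho>\<close> on \<open>A\<close>, the latter does not meet \<open>A\<close>.\<close>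
  define A' where "A' = (A \<union> E) \<inter> {z \<in> topspace Z. nrm z \<in> {\<rho>/2..}}"
  define C where "C = (A \<union> E) \<inter> {z \<in> topspace Z. nrm z \<in> {..\<rho>/2}}"
  have cl: "closedin Z A'" "closedin Z C"
    unfolding A'_def C_def
    by (intro closedin_Int E(1) closedin_continuous_map_preimage[OF cont_nrm]; simp)+
  have "\<sigma> ` A' \<subseteq> A'" using A(2) E(2) AEZ nrm_\<sigma> by (auto simp: A'_def)
  moreover have "nonvanishing_on N \<psi> A'"
    using \<rho>(1) by (auto simp: nonvanishing_on_iff_sum A'_def nrm_def)
  moreover have CE: "C \<subseteq> E"
  proof
    fix z assume z: "z \<in> C"
    then have "z \<notin> A" using \<rho>(1) \<rho>(2)[of z] by (auto simp: C_def)
    then show "z \<in> E" using z by (simp add: C_def)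
  qed
  moreover have "\<exists>W e. openin Z W \<and> z \<in> W \<and> W \<inter> \<sigma> ` W = {} \<and>
      real_coordinates (subtopology Z (W \<inter> C)) k e" if "z \<in> C" for z
  proof -
    have z: "z \<in> topspace Z" using that AEZ CE by auto
    then have "\<sigma> z \<in> topspace Z" "z \<noteq> \<sigma> z" by (simp, metis \<sigma>_simps(2))
    then obtain U V where UV: "openin Z U" "openin Z V" "z \<in> U" "\<sigma> z \<in> V" "disjnt U V"
      using Hausdorff_Z z unfolding Hausdorff_space_def by metis
    define W where "W = U \<inter> {y \<in> topspace Z. \<sigma> y \<in> V}"
    have "openin Z W"
      unfolding W_def using UV cont_\<sigma> by (intro openin_Int openin_continuous_map_preimage)
    moreover have "z \<in> W" using UV z by (simp add: W_def)
    moreover have disj: "W \<inter> \<sigma> ` W = {}" using UV(5) by (auto simp: W_def disjnt_iff)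
    moreover have "real_coordinates (subtopology Z (W \<inter> C)) k e"
      unfolding real_coordinates_def
    proof (intro conjI allI ballI impI)
      show "continuous_map (subtopology Z (W \<inter> C)) euclideanreal (e l)" if "l < k" for l
        using cont_e[OF that] CE by (auto intro: continuous_map_from_subtopology_mono)
      fix x y assume "x \<in> topspace (subtopology Z (W \<inter> C))" "y \<in> topspace (subtopology Z (W \<inter> C))"
        and "\<forall>l<k. e l x = e l y"
      moreover from this have "y \<noteq> \<sigma> x" using disj by auto
      ultimately show "x = y" using sep[of x y] CE by auto
    qed
    ultimately show ?thesis by blast
  qed
  ultimately obtain \<psi>' where \<psi>': "odd_family Z \<sigma> N \<psi>'" "nonvanishing_on N \<psi>' (A' \<union> C)"
    using odd_extension_over_charts[OF cl(1) _ A(3) _ cl(2) \<open>k < N\<close>] by metis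
  have "A \<union> E \<subseteq> A' \<union> C" using AEZ by (auto simp: A'_def C_def)
  then show thesis using that[OF \<psi>'(1) nonvanishing_on_subset[OF \<psi>'(2)]] by simp
qed

end


section \<open>Odd maps between spheres\<close>

lemma compact_space_bounded_closed_coordinates:
  assumes "closedin (powertop_real UNIV) S" "\<And>x i. x \<in> S \<Longrightarrow> \<bar>x i :: real\<bar> \<le> 1"
  shows "compact_space (subtopology (powertop_real UNIV) S)"
proof -
  have "compactin (powertop_real UNIV) (PiE UNIV (\<lambda>i. {-1..1}))"
    by (simp add: compactin_PiE)
  moreover have "S \<subseteq> PiE UNIV (\<lambda>i. {-1..1})"
    using assms(2) by (force simp: abs_le_iff)
  ultimately have "compactin (powertop_real UNIV) S"
    using assms(1) closed_compactin by blast
  then show ?thesis by (rule compact_space_subtopology)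
qed

lemma closedin_coordinate_equation:
  assumes "continuous_map (powertop_real UNIV) euclideanreal g" "closed T"
  shows "closedin (powertop_real UNIV) {x. g x \<in> T}"
  using closedin_continuous_map_preimage[OF assms(1), of T] assms(2) by simp

lemma compact_space_nsphere: "compact_space (nsphere n)"
  unfolding nsphere
proof (rule compact_space_bounded_closed_coordinates)
  let ?S = "{x :: nat \<Rightarrow> real. (\<Sum>i\<le>n. (x i)\<^sup>2) = 1 \<and> (\<forall>i>n. x i = 0)}"
  have "?S = {x. (\<Sum>i\<le>n. (x i)\<^sup>2) \<in> {1}} \<inter> (\<Inter>i. {x. (if i > n then x i else 0) \<in> {0}})"
    by auto
  moreover have "closedin (powertop_real UNIV) {x. (\<Sum>i\<le>n. (x i)\<^sup>2) \<in> {1}}"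
    by (intro closedin_coordinate_equation continuous_intros continuous_map_product_projection) auto
  moreover have "closedin (powertop_real UNIV) {x. (if i > n then x i else 0) \<in> {0}}" for i
    by (intro closedin_coordinate_equation)
      (auto intro: continuous_map_product_projection)
  ultimately show "closedin (powertop_real UNIV) ?S"
    by (metis (no_types, lifting) closedin_Int closedin_INT UNIV_not_empty)
  show "\<bar>x i\<bar> \<le> 1" if "x \<in> ?S" for x i
  proof (cases "i \<le> n")
    case True
    then have "(x i)\<^sup>2 \<le> (\<Sum>i\<le>n. (x i)\<^sup>2)" by (intro member_le_sum) auto
    then show ?thesis using that by (simp add: abs_square_le_1)
  qed (use that in auto)
qed

definition radial_map :: "nat \<Rightarrow> (nat \<Rightarrow> 'a \<Rightarrow> real) \<Rightarrow> 'a \<Rightarrow> nat \<Rightarrow> real" where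
  "radial_map n f x = (\<lambda>i. if i \<le> n then f i x / sqrt (\<Sum>j\<le>n. (f j x)\<^sup>2) else 0)"

lemma nonvanishing_sum_squares:
  assumes "nonvanishing_on (Suc n) f A" "x \<in> A"
  shows "0 < (\<Sum>j\<le>n. (f j x)\<^sup>2)"
proof -
  obtain j where j: "j \<le> n" "f j x \<noteq> 0"
    using assms by (auto simp: nonvanishing_on_def less_Suc_eq_le)
  have "0 < (f j x)\<^sup>2" using j by simp
  also have "\<dots> \<le> (\<Sum>j\<le>n. (f j x)\<^sup>2)" using j by (intro member_le_sum) auto
  finally show ?thesis .
qed

lemma continuous_map_radial_map:
  assumes "\<And>j. j \<le> n \<Longrightarrow> continuous_map X euclideanreal (f j)"
    and "nonvanishing_on (Suc n) f (topspace X)"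
  shows "continuous_map X (nsphere n) (radial_map n f)"
proof -
  have pos: "0 < (\<Sum>j\<le>n. (f j x)\<^sup>2)" if "x \<in> topspace X" for x
    using nonvanishing_sum_squares[OF assms(2) that] .
  have "continuous_map X euclideanreal (\<lambda>x. radial_map n f x i)" for i
  proof (cases "i \<le> n")
    case True
    have "continuous_map X euclideanreal (\<lambda>x. sqrt (\<Sum>j\<le>n. (f j x)\<^sup>2))"
      by (intro continuous_map_sqrt continuous_intros assms(1)) auto
    then show ?thesis
      using True assms(1) order_less_imp_not_eq2[OF pos] unfolding radial_map_def
      by (auto intro!: continuous_map_real_divide)
  qed (simp add: radial_map_def)
  moreover have "(\<Sum>i\<le>n. (radial_map n f x i)\<^sup>2) = 1" if "x \<in> topspace X" for x
  proof -
    have "(\<Sum>i\<le>n. (radial_map n f x i)\<^sup>2) = (\<Sum>i\<le>n. (f i x)\<^sup>2 / (\<Sum>j\<le>n. (f j x)\<^sup>2))"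
      using pos[OF that] by (intro sum.cong) (auto simp: radial_map_def power_divide)
    also have "\<dots> = 1" using pos[OF that] by (simp flip: sum_divide_distrib)
    finally show ?thesis .
  qed
  ultimately show ?thesis
    by (auto simp: nsphere continuous_map_in_subtopology continuous_map_componentwise_UNIV)
       (simp add: radial_map_def)
qed

lemma radial_map_antipode:
  assumes "\<And>j. j \<le> n \<Longrightarrow> f j y = - f j x"
  shows "radial_map n f y = antipode (radial_map n f x)"
  using assms by (auto simp: radial_map_def antipode_def)

lemma radial_map_unit:
  assumes "f x \<in> topspace (nsphere n)"
  shows "radial_map n (\<lambda>j x. f x j) x = f x"
  using assms by (auto simp: radial_map_def nsphere)

lemma homotopic_radial_maps:
  assumes "\<And>j. j \<le> n \<Longrightarrow> continuous_map (prod_topology (top_of_set {0..1::real}) X) euclideanreal (H j)"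
    and "nonvanishing_on (Suc n) H ({0..1} \<times> topspace X)"
  shows "homotopic_with (\<lambda>_. True) X (nsphere n)
    (radial_map n (\<lambda>j x. H j (0, x))) (radial_map n (\<lambda>j x. H j (1, x)))"
  unfolding homotopic_with_def
proof (intro exI[of _ "radial_map n H"] conjI)
  show "continuous_map (prod_topology (top_of_set {0..1}) X) (nsphere n) (radial_map n H)"
    using assms by (intro continuous_map_radial_map) auto
qed (auto simp: radial_map_def)

lemma compact_free_involution_nsphere: "compact_free_involution (nsphere n) antipode"
  by (simp add: compact_free_involution_def compact_space_nsphere Hausdorff_space_nsphere
      free_involution_antipode)

text \<open>The equator needs only \<open>n\<close> coordinates near \<open>z\<close>: besides the last one, a coordinate \<open>i\<close> with
  \<open>z i \<noteq> 0\<close> can be dropped, since its sign is constant near \<open>z\<close> and its square is determined by the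
  others.\<close>

lemma equator_chart:
  assumes z: "z \<in> topspace (nsphere (Suc n))" "z (Suc n) = 0"
  defines "C \<equiv> {x \<in> topspace (nsphere (Suc n)). x (Suc n) \<in> {0}}"
  shows "\<exists>W e. openin (nsphere (Suc n)) W \<and> z \<in> W \<and> W \<inter> antipode ` W = {} \<and>
    real_coordinates (subtopology (nsphere (Suc n)) (W \<inter> C)) n e"
proof -
  have "\<exists>i\<le>n. z i \<noteq> 0"
  proof (rule ccontr)
    assume "\<not> ?thesis"
    then have "(\<Sum>i\<le>Suc n. (z i)\<^sup>2) = 0" using z(2) by simp
    then show False using z(1) by (simp add: nsphere)
  qed
  then obtain i where i: "i \<le> n" "z i \<noteq> 0" by blast
  define W where "W = {x \<in> topspace (nsphere (Suc n)). z i * x i \<in> {0<..}}"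
  define e where "e l x = x (if l < i then l else Suc l)" for l and x :: "nat \<Rightarrow> real"
  have "openin (nsphere (Suc n)) W"
    unfolding W_def
    by (rule openin_continuous_map_preimage[where Y = euclideanreal])
      (auto intro!: continuous_intros continuous_map_nsphere_projection)
  moreover have "z \<in> W" using z i by (auto simp: W_def zero_less_mult_iff)
  moreover have "W \<inter> antipode ` W = {}"
    by (auto simp: W_def antipode_def)
  moreover have "real_coordinates (subtopology (nsphere (Suc n)) (W \<inter> C)) n e"
    unfolding real_coordinates_def
  proof (intro conjI allI ballI impI)
    show "continuous_map (subtopology (nsphere (Suc n)) (W \<inter> C)) euclideanreal (e l)" for l
      unfolding e_def
      by (intro continuous_map_from_subtopology continuous_map_nsphere_projection)
    fix x y assume "x \<in> topspace (subtopology (nsphere (Suc n)) (W \<inter> C))"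
      "y \<in> topspace (subtopology (nsphere (Suc n)) (W \<inter> C))" and eq: "\<forall>l<n. e l x = e l y"
    then have xy: "x \<in> W" "x \<in> C" "y \<in> W" "y \<in> C" by auto
    have on_C: "(\<Sum>j\<le>n. (x j)\<^sup>2) = 1" "\<And>j. j > n \<Longrightarrow> x j = 0" if "x \<in> C" for x
    proof -
      have sum: "(\<Sum>j\<le>Suc n. (x j)\<^sup>2) = 1" and zero: "\<And>j. j > Suc n \<Longrightarrow> x j = 0"
        and last: "x (Suc n) = 0"
        using that by (auto simp: C_def nsphere)
      show "(\<Sum>j\<le>n. (x j)\<^sup>2) = 1" using sum last by simp
      show "x j = 0" if "j > n" for j using that last zero by (cases "j = Suc n") auto
    qed
    have x: "(\<Sum>j\<le>n. (x j)\<^sup>2) = 1" "\<And>j. j > n \<Longrightarrow> x j = 0" "0 < z i * x i"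
      and y: "(\<Sum>j\<le>n. (y j)\<^sup>2) = 1" "\<And>j. j > n \<Longrightarrow> y j = 0" "0 < z i * y i"
      using on_C[OF xy(2)] on_C[OF xy(4)] xy(1,3) by (auto simp: W_def)
    have other: "x j = y j" if "j \<noteq> i" for j
    proof (cases "j \<le> n")
      case True
      show ?thesis
      proof (cases "j < i")
        case True
        then show ?thesis using eq i by (auto simp: e_def dest: spec[of _ j])
      next
        case False
        then have "e (j - 1) x = e (j - 1) y" "Suc (j - 1) = j" "\<not> j - 1 < i"
          using eq \<open>j \<le> n\<close> \<open>j \<noteq> i\<close> by auto
        then show ?thesis by (simp add: e_def)
      qed
    qed (use x y in auto)
    have "(\<Sum>j\<le>n. (x j)\<^sup>2) = (x i)\<^sup>2 + (\<Sum>j\<in>{..n} - {i}. (x j)\<^sup>2)"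
      "(\<Sum>j\<le>n. (y j)\<^sup>2) = (y i)\<^sup>2 + (\<Sum>j\<in>{..n} - {i}. (y j)\<^sup>2)"
      using i by (auto intro!: sum.remove)
    moreover have "(\<Sum>j\<in>{..n} - {i}. (x j)\<^sup>2) = (\<Sum>j\<in>{..n} - {i}. (y j)\<^sup>2)"
      using other by (intro sum.cong) auto
    ultimately have "(x i)\<^sup>2 = (y i)\<^sup>2" using x y by simp
    then have "x i = y i \<or> x i = - y i" by (simp add: power2_eq_iff)
    then have "x i = y i" using x(3) y(3) by auto
    then show "x = y" using other by (metis ext)
  qed
  ultimately show ?thesis by blast
qed

text \<open>Let \<open>\<psi>\<close> consist of all components of \<open>f\<close> but the last.  Where the last component is at most
  \<open>1/2\<close> in absolute value, \<open>\<psi>\<close> has no zero; it can be modified elsewhere to an odd \<open>\<psi>'\<close> without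
  zeros on the equator, which has dimension \<open>n\<close> while \<open>\<psi>'\<close> has \<open>n + 1\<close> components.  Where
  \<open>\<psi>\<close> and \<open>\<psi>'\<close> differ, the last component of \<open>f\<close> is nonzero and keeps the straight-line
  homotopy away from the origin.  At the same time the last component is multiplied by a factor that
  deforms from \<open>1\<close> to \<open>(x (Suc n))\<^sup>2\<close>, an even function vanishing exactly on the equator.\<close>

lemma odd_sphere_map_homotopic_to_equator_preserving:
  assumes f: "continuous_map (nsphere (Suc n)) (nsphere (Suc n)) f"
    "\<And>x. x \<in> topspace (nsphere (Suc n)) \<Longrightarrow> f (antipode x) = antipode (f x)"
  obtains g where "continuous_map (nsphere (Suc n)) (nsphere (Suc n)) g"
    "\<And>x. x \<in> topspace (nsphere (Suc n)) \<Longrightarrow> g (antipode x) = antipode (g x)"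
    "g ` topspace (nsphere n) \<subseteq> topspace (nsphere n)"
    "homotopic_with (\<lambda>_. True) (nsphere (Suc n)) (nsphere (Suc n)) f g"
proof -
  let ?S = "nsphere (Suc n)"
  interpret compact_free_involution ?S antipode
    by (rule compact_free_involution_nsphere)
  have fS: "f x \<in> topspace ?S" if "x \<in> topspace ?S" for x
    using f(1) that by (auto simp: continuous_map_def)
  have cont_f: "continuous_map ?S euclideanreal (\<lambda>x. f x j)" for j
    using continuous_map_compose[OF f(1) continuous_map_nsphere_projection] by (simp add: o_def)
  define \<psi> where "\<psi> j x = f x j" for j x
  define A where "A = {x \<in> topspace ?S. f x (Suc n) \<in> {-1/2..1/2}}"
  define C where "C = {x \<in> topspace ?S. x (Suc n) \<in> {0}}"
  have clA: "closedin ?S A"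
    unfolding A_def by (rule closedin_continuous_map_preimage[OF cont_f]) auto
  have clC: "closedin ?S C"
    unfolding C_def by (rule closedin_continuous_map_preimage[OF continuous_map_nsphere_projection]) auto
  have invA: "antipode ` A \<subseteq> A"
    using f(2) by (auto simp: A_def) (auto simp: antipode_def)
  have odd_\<psi>: "odd_family ?S antipode (Suc n) \<psi>"
    using f(2) cont_f by (auto simp: odd_family_def \<psi>_def[abs_def]) (auto simp: antipode_def)
  have nvA: "nonvanishing_on (Suc n) \<psi> A"
    unfolding nonvanishing_on_def
  proof
    fix x assume x: "x \<in> A"
    show "\<exists>j<Suc n. \<psi> j x \<noteq> 0"
    proof (rule ccontr)
      assume "\<not> ?thesis"
      then have "(\<Sum>j\<le>Suc n. (f x j)\<^sup>2) = (f x (Suc n))\<^sup>2"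
        by (simp add: \<psi>_def less_Suc_eq_le)
      moreover have "(\<Sum>j\<le>Suc n. (f x j)\<^sup>2) = 1"
        using fS[of x] x by (simp add: A_def nsphere)
      ultimately have "\<bar>f x (Suc n)\<bar> = 1" by (auto simp: power2_eq_1_iff)
      then show False using x by (auto simp: A_def)
    qed
  qed
  obtain \<psi>' where \<psi>': "odd_family ?S antipode (Suc n) \<psi>'"
    "\<And>j z. \<lbrakk>j < Suc n; z \<in> A\<rbrakk> \<Longrightarrow> \<psi>' j z = \<psi> j z" "nonvanishing_on (Suc n) \<psi>' (A \<union> C)"
  proof (rule odd_extension_over_charts[OF clA invA odd_\<psi> nvA clC lessI])
    fix z assume "z \<in> C"
    then show "\<exists>W e. openin ?S W \<and> z \<in> W \<and> W \<inter> antipode ` W = {} \<and>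
        real_coordinates (subtopology ?S (W \<inter> C)) n e"
      using equator_chart[of z n] by (simp add: C_def)
  qed (rule that; assumption)
  define H where "H j p =
    (if j \<le> n then (1 - fst p) * \<psi> j (snd p) + fst p * \<psi>' j (snd p)
     else f (snd p) (Suc n) * ((1 - fst p) + fst p * (snd p (Suc n))\<^sup>2))"
    for j and p :: "real \<times> (nat \<Rightarrow> real)"
  let ?I = "top_of_set {0..1::real}"
  have cont2: "continuous_map (prod_topology ?I ?S) euclideanreal (\<lambda>p. h (snd p))"
    if "continuous_map ?S euclideanreal h" for h
    using continuous_map_compose[OF continuous_map_snd that] by (simp add: o_def)
  have cont1: "continuous_map (prod_topology ?I ?S) euclideanreal fst"
    by (rule continuous_map_into_fulltopology[OF continuous_map_fst])
  have contH: "continuous_map (prod_topology ?I ?S) euclideanreal (H j)" for j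
  proof (cases "j \<le> n")
    case True
    then have "continuous_map ?S euclideanreal (\<psi> j)" "continuous_map ?S euclideanreal (\<psi>' j)"
      using odd_\<psi> \<psi>'(1) by (auto simp: odd_family_def less_Suc_eq_le)
    then show ?thesis using True
      by (auto simp: H_def[abs_def] intro!: continuous_intros cont1 cont2)
  next
    case False
    then show ?thesis
      by (auto simp: H_def[abs_def] intro!: continuous_intros cont1 cont2[OF cont_f]
          cont2[OF continuous_map_nsphere_projection])
  qed
  have nvH: "nonvanishing_on (Suc (Suc n)) H ({0..1} \<times> topspace ?S)"
    unfolding nonvanishing_on_def
  proof clarify
    fix t :: real and x assume t: "t \<in> {0..1}" and x: "x \<in> topspace ?S"
    show "\<exists>j<Suc (Suc n). H j (t, x) \<noteq> 0"
    proof (cases "x \<in> A")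
      case True
      then obtain j where j: "j < Suc n" "\<psi> j x \<noteq> 0" using nvA by (auto simp: nonvanishing_on_def)
      have "H j (t, x) = \<psi> j x"
        using j(1) \<psi>'(2)[OF j(1) True] by (simp add: H_def less_Suc_eq_le algebra_simps)
      with j show ?thesis by (intro exI[of _ j]) auto
    next
      case False
      then have fx: "f x (Suc n) \<noteq> 0" using x by (auto simp: A_def)
      show ?thesis
      proof (cases "(1 - t) + t * (x (Suc n))\<^sup>2 = 0")
        case True
        moreover have "0 \<le> t * (x (Suc n))\<^sup>2" using t by simp
        moreover have "t \<le> 1" using t by simp
        ultimately have "t * (x (Suc n))\<^sup>2 = 0" "t = 1" by linarith+
        then have "t = 1" "x (Suc n) = 0" by auto
        then have "x \<in> A \<union> C" using x by (simp add: C_def)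
        then obtain j where j: "j < Suc n" "\<psi>' j x \<noteq> 0"
          using \<psi>'(3) by (auto simp: nonvanishing_on_def)
        with \<open>t = 1\<close> have "H j (t, x) \<noteq> 0" by (simp add: H_def less_Suc_eq_le)
        with j show ?thesis by (intro exI[of _ j]) auto
      next
        case False
        with fx show ?thesis by (intro exI[of _ "Suc n"]) (simp add: H_def)
      qed
    qed
  qed
  define g where "g = radial_map (Suc n) (\<lambda>j x. H j (1, x))"
  have hom: "homotopic_with (\<lambda>_. True) ?S ?S (radial_map (Suc n) (\<lambda>j x. H j (0, x))) g"
    unfolding g_def using contH nvH by (intro homotopic_radial_maps)
  have cont_g: "continuous_map ?S ?S g" using homotopic_with_imp_continuous_maps[OF hom] by (rule conjunct2)
  have "radial_map (Suc n) (\<lambda>j x. H j (0, x)) x = f x" if "x \<in> topspace ?S" for x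
  proof -
    have "radial_map (Suc n) (\<lambda>j x. H j (0, x)) x = radial_map (Suc n) (\<lambda>j x. f x j) x"
      by (rule ext) (auto simp: radial_map_def H_def \<psi>_def le_Suc_eq)
    then show ?thesis using radial_map_unit[of f x "Suc n", OF fS[OF that]] by simp
  qed
  then have "homotopic_with (\<lambda>_. True) ?S ?S f g"
    using homotopic_with_eq[OF hom] by simp
  moreover have "g (antipode x) = antipode (g x)" if x: "x \<in> topspace ?S" for x
    unfolding g_def
  proof (rule radial_map_antipode)
    fix j assume "j \<le> Suc n"
    show "H j (1, antipode x) = - H j (1, x)"
      using \<psi>'(1) x f(2)[OF x]
      by (auto simp: H_def odd_family_def less_Suc_eq_le) (auto simp: antipode_def)
  qed
  moreover have "g ` topspace (nsphere n) \<subseteq> topspace (nsphere n)"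
  proof
    fix y assume "y \<in> g ` topspace (nsphere n)"
    then obtain x where x: "x \<in> topspace (nsphere n)" "y = g x" by blast
    have eq: "topspace (nsphere n) = topspace ?S \<inter> {x. x (Suc n) = 0}"
      by (subst subtopology_nsphere_equator[symmetric]) simp
    have "x \<in> topspace ?S" "x (Suc n) = 0" using x(1) unfolding eq by auto
    moreover from this have "y (Suc n) = 0" by (simp add: x(2) g_def radial_map_def H_def)
    ultimately show "y \<in> topspace (nsphere n)"
      using cont_g unfolding eq by (auto simp: x(2) continuous_map_def)
  qed
  ultimately show thesis using cont_g by (intro that[of g])
qed

text \<open>After a homotopy the map preserves the equator, and then its degree has the parity of the degree
  of its restriction to the equator.\<close>

theorem odd_sphere_map_odd_degree:
  assumes "continuous_map (nsphere n) (nsphere n) f"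
    "\<And>x. x \<in> topspace (nsphere n) \<Longrightarrow> f (antipode x) = antipode (f x)"
  shows "odd (Brouwer_degree2 n f)"
  using assms
proof (induction n arbitrary: f)
  case 0
  have S0: "x \<in> topspace (nsphere 0) \<longleftrightarrow> (x 0 = 1 \<or> x 0 = -1) \<and> (\<forall>i>0. x i = 0)" for x
    by (auto simp: nsphere power2_eq_1_iff)
  have pm: "y = x \<or> y = antipode x" if "x \<in> topspace (nsphere 0)" "y \<in> topspace (nsphere 0)" for x y
  proof -
    have "y 0 = x 0 \<or> y 0 = - x 0" using that unfolding S0 by auto
    moreover have "y i = 0" "x i = 0" if "i \<noteq> 0" for i
      using that \<open>x \<in> _\<close> \<open>y \<in> _\<close> unfolding S0 by auto
    ultimately show ?thesis unfolding antipode_def fun_eq_iff by (metis minus_zero)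
  qed
  have "f (f x) = x" if x: "x \<in> topspace (nsphere 0)" for x
  proof -
    have fx: "f x \<in> topspace (nsphere 0)" using 0(1) x by (auto simp: continuous_map_def)
    have "antipode (antipode x) = x" by (simp add: antipode_def)
    with pm[OF x fx] 0(2)[OF x] show ?thesis by auto
  qed
  then have "homeomorphic_map (nsphere 0) (nsphere 0) f"
    unfolding homeomorphic_map_maps homeomorphic_maps_def using 0(1) by (intro exI[of _ f]) auto
  then have "\<bar>Brouwer_degree2 0 f\<bar> = 1" by (rule Brouwer_degree2_homeomorphic_map)
  then show ?case by presburger
next
  case (Suc n)
  obtain g where g: "continuous_map (nsphere (Suc n)) (nsphere (Suc n)) g"
    "\<And>x. x \<in> topspace (nsphere (Suc n)) \<Longrightarrow> g (antipode x) = antipode (g x)"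
    "g ` topspace (nsphere n) \<subseteq> topspace (nsphere n)"
    "homotopic_with (\<lambda>_. True) (nsphere (Suc n)) (nsphere (Suc n)) f g"
    using odd_sphere_map_homotopic_to_equator_preserving[OF Suc.prems] by blast
  have sub: "nsphere n = subtopology (nsphere (Suc n)) {x. x (Suc n) = 0}"
    by (simp add: subtopology_nsphere_equator)
  have "continuous_map (nsphere n) (nsphere (Suc n)) g"
    using g(1) unfolding sub by (rule continuous_map_from_subtopology)
  moreover have "g x \<in> {x. x (Suc n) = 0}" if "x \<in> topspace (nsphere n)" for x
    using g(3) that unfolding sub by auto
  ultimately have "continuous_map (nsphere n) (nsphere n) g"
    by (subst (2) sub) (auto simp: continuous_map_in_subtopology)
  moreover have "g (antipode x) = antipode (g x)" if "x \<in> topspace (nsphere n)" for x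
    using that g(2) unfolding sub by auto
  ultimately have "odd (Brouwer_degree2 n g)" by (rule Suc.IH)
  moreover have "even (Brouwer_degree2 (Suc n) g - Brouwer_degree2 (Suc n - Suc 0) g)"
    using g by (intro Borsuk_odd_mapping_degree_step) (auto simp: antipode_def[abs_def])
  ultimately show ?case using Brouwer_degree2_homotopic[OF g(4)] by simp
qed

text \<open>Normalising a family without zeros, padded with zero components, would give an odd self-map of the
  sphere that misses the last unit vector and hence has degree \<open>0\<close>, which is even.\<close>

corollary Borsuk_Ulam_odd_family:
  assumes "odd_family (nsphere M) antipode N w" "N \<le> M"
  shows "\<not> nonvanishing_on N w (topspace (nsphere M))"
proof
  assume nv: "nonvanishing_on N w (topspace (nsphere M))"
  define w' where "w' j x = (if j < N then w j x else 0)" for j x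
  define f where "f = radial_map M w'"
  have cont: "continuous_map (nsphere M) (nsphere M) f"
    unfolding f_def
  proof (rule continuous_map_radial_map)
    show "continuous_map (nsphere M) euclideanreal (w' j)" for j
      using assms(1) by (cases "j < N") (auto simp: odd_family_def w'_def[abs_def])
    show "nonvanishing_on (Suc M) w' (topspace (nsphere M))"
      using nv \<open>N \<le> M\<close> unfolding nonvanishing_on_def w'_def
      by (metis (full_types) less_SucI order_less_le_trans)
  qed
  have "f (antipode x) = antipode (f x)" if "x \<in> topspace (nsphere M)" for x
    unfolding f_def using assms(1) that
    by (intro radial_map_antipode) (auto simp: w'_def odd_family_def)
  with cont have "odd (Brouwer_degree2 M f)" by (rule odd_sphere_map_odd_degree)
  moreover have "(\<lambda>i. if i = M then 1 else 0) \<in> topspace (nsphere M) - f ` topspace (nsphere M)"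
  proof -
    have "f x M = 0" for x using \<open>N \<le> M\<close> by (simp add: f_def radial_map_def w'_def)
    moreover have "(\<Sum>i\<le>M. (if i = M then 1 else 0 :: real)\<^sup>2) = 1"
      by (simp add: if_distrib[of "\<lambda>x. x\<^sup>2"] cong: if_cong)
    ultimately show ?thesis by (auto simp: nsphere fun_eq_iff) (metis zero_neq_one)
  qed
  then have "f ` topspace (nsphere M) \<noteq> topspace (nsphere M)" by blast
  then have "Brouwer_degree2 M f = 0" using cont Brouwer_degree2_nonsurjective by blast
  ultimately show False by simp
qed


section \<open>Manifolds\<close>

lemma manifold_chart:
  assumes "topological_manifold d Y" "y \<in> topspace Y"
  obtains U a where "openin Y U" "y \<in> U" "real_coordinates (subtopology Y U) d a"
proof -
  obtain U V where UV: "openin Y U" "y \<in> U"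
    "subtopology Y U homeomorphic_space subtopology (Euclidean_space d) V"
    using assms unfolding topological_manifold_def by metis
  then obtain f where f: "homeomorphic_map (subtopology Y U) (subtopology (Euclidean_space d) V) f"
    by (auto simp: homeomorphic_space)
  then have cont: "continuous_map (subtopology Y U) (Euclidean_space d) f"
    and inj: "inj_on f (topspace (subtopology Y U))"
    by (auto simp: homeomorphic_eq_everything_map continuous_map_in_subtopology)
  have "real_coordinates (subtopology Y U) d (\<lambda>l x. f x l)"
    unfolding real_coordinates_def
  proof (intro conjI allI ballI impI)
    show "continuous_map (subtopology Y U) euclideanreal (\<lambda>x. f x l)" for l
      using cont by (simp add: Euclidean_space_def continuous_map_in_subtopology
          continuous_map_componentwise_UNIV)
    fix x x' assume x: "x \<in> topspace (subtopology Y U)" "x' \<in> topspace (subtopology Y U)"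
      and eq: "\<forall>l<d. f x l = f x' l"
    have "f x \<in> topspace (Euclidean_space d)" "f x' \<in> topspace (Euclidean_space d)"
      using x cont unfolding continuous_map_def by blast+
    then have "f x l = f x' l" for l
      using eq by (cases "l < d") (auto simp: topspace_Euclidean_space)
    then show "x = x'" using inj x by (simp add: inj_on_def fun_eq_iff)
  qed
  with UV show thesis using that by blast
qed

lemma manifold_locally_compact:
  assumes "topological_manifold d Y"
  shows "locally_compact_space Y"
  unfolding locally_compact_space_def
proof
  fix y assume "y \<in> topspace Y"
  then obtain U V where UV: "openin Y U" "y \<in> U" "openin (Euclidean_space d) V"
    "subtopology Y U homeomorphic_space subtopology (Euclidean_space d) V"
    using assms unfolding topological_manifold_def by metis
  have "Hausdorff_space (Euclidean_space d)"
    unfolding Euclidean_space_def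
    by (intro Hausdorff_space_subtopology) (simp add: Hausdorff_space_product_topology)
  then have "locally_compact_space (subtopology (Euclidean_space d) V)"
    using UV(3) locally_compact_Euclidean_space locally_compact_space_open_subset by blast
  then have "locally_compact_space (subtopology Y U)"
    using UV(4) homeomorphic_locally_compact_space by blast
  moreover have "y \<in> topspace (subtopology Y U)" using UV \<open>y \<in> topspace Y\<close> by simp
  ultimately obtain U' K where "openin (subtopology Y U) U'" "compactin (subtopology Y U) K"
    "y \<in> U'" "U' \<subseteq> K"
    unfolding locally_compact_space_def by blast
  then show "\<exists>U K. openin Y U \<and> compactin Y K \<and> y \<in> U \<and> U \<subseteq> K"
    using UV(1) openin_trans_full compactin_subtopology by metis
qed

lemma compact_free_involution_swap:
  assumes "Hausdorff_space Y" "compactin (prod_topology Y Y) K" "prod.swap ` K \<subseteq> K"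
    "\<And>p. p \<in> K \<Longrightarrow> fst p \<noteq> snd p"
  shows "compact_free_involution (subtopology (prod_topology Y Y) K) prod.swap"
proof
  show "compact_space (subtopology (prod_topology Y Y) K)"
    using assms(2) by (rule compact_space_subtopology)
  show "Hausdorff_space (subtopology (prod_topology Y Y) K)"
    using assms(1) by (simp add: Hausdorff_space_subtopology Hausdorff_space_prod_topology)
  have "continuous_map (prod_topology Y Y) (prod_topology Y Y) prod.swap"
    unfolding prod.swap_def
    by (intro continuous_map_pairedI continuous_map_fst continuous_map_snd)
  then have "continuous_map (subtopology (prod_topology Y Y) K)
      (subtopology (prod_topology Y Y) K) prod.swap"
    using assms(3) by (auto simp: continuous_map_in_subtopology continuous_map_from_subtopology)
  then show "free_involution (subtopology (prod_topology Y Y) K) prod.swap"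
    using assms(4) by (force simp: free_involution_def prod.swap_def prod_eq_iff)
qed

text \<open>Disjoint neighbourhoods of the two entries of \<open>p\<close> give a product neighbourhood that does not meet
  its mirror image.\<close>

lemma manifold_square_chart:
  assumes Y: "topological_manifold d Y" and p: "p \<in> K" "K \<subseteq> topspace (prod_topology Y Y)"
    "fst p \<noteq> snd p"
  shows "\<exists>W e. openin (subtopology (prod_topology Y Y) K) W \<and> p \<in> W \<and> W \<inter> prod.swap ` W = {} \<and>
    real_coordinates (subtopology (subtopology (prod_topology Y Y) K) (W \<inter> K)) (d + d) e"
proof -
  have Y2: "fst p \<in> topspace Y" "snd p \<in> topspace Y" using p by auto
  obtain U1 a1 where U1: "openin Y U1" "fst p \<in> U1" "real_coordinates (subtopology Y U1) d a1"
    using manifold_chart[OF Y Y2(1)] .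
  obtain U2 a2 where U2: "openin Y U2" "snd p \<in> U2" "real_coordinates (subtopology Y U2) d a2"
    using manifold_chart[OF Y Y2(2)] .
  have "Hausdorff_space Y" using Y by (simp add: topological_manifold_def)
  then obtain V1 V2 where V: "openin Y V1" "openin Y V2" "fst p \<in> V1" "snd p \<in> V2" "disjnt V1 V2"
    using Y2 p(3) unfolding Hausdorff_space_def by metis
  define W where "W = ((U1 \<inter> V1) \<times> (U2 \<inter> V2)) \<inter> K"
  define e where "e l q = (if l < d then a1 l (fst q) else a2 (l - d) (snd q))" for l q
  let ?S = "subtopology (subtopology (prod_topology Y Y) K) (W \<inter> K)"
  have "openin (subtopology (prod_topology Y Y) K) W"
    unfolding W_def openin_subtopology
    by (intro exI[of _ "(U1 \<inter> V1) \<times> (U2 \<inter> V2)"]) (auto simp: openin_prod_Times_iff U1 U2 V)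
  moreover have "p \<in> W" using U1 U2 V p by (cases p) (auto simp: W_def)
  moreover have "W \<inter> prod.swap ` W = {}" using V(5) by (auto simp: W_def disjnt_iff)
  moreover have "real_coordinates ?S (d + d) e"
    unfolding real_coordinates_def
  proof (intro conjI allI ballI impI)
    fix l assume l: "l < d + d"
    have S: "?S = subtopology (prod_topology Y Y) W"
      by (simp add: subtopology_subtopology W_def Int_assoc Int_commute Int_left_commute)
    have c1: "continuous_map ?S (subtopology Y U1) fst" and c2: "continuous_map ?S (subtopology Y U2) snd"
      unfolding S by (auto simp: continuous_map_in_subtopology W_def
          intro!: continuous_map_from_subtopology continuous_map_fst continuous_map_snd)
    show "continuous_map ?S euclideanreal (e l)"
    proof (cases "l < d")
      case True
      then have "continuous_map (subtopology Y U1) euclideanreal (a1 l)"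
        using U1(3) by (simp add: real_coordinates_def)
      from continuous_map_compose[OF c1 this] True show ?thesis by (simp add: e_def[abs_def] o_def)
    next
      case False
      then have "continuous_map (subtopology Y U2) euclideanreal (a2 (l - d))"
        using U2(3) l by (simp add: real_coordinates_def)
      from continuous_map_compose[OF c2 this] False show ?thesis by (simp add: e_def[abs_def] o_def)
    qed
  next
    fix q r assume "q \<in> topspace ?S" "r \<in> topspace ?S" and eq: "\<forall>l<d + d. e l q = e l r"
    then have qr: "fst q \<in> topspace (subtopology Y U1)" "fst r \<in> topspace (subtopology Y U1)"
      "snd q \<in> topspace (subtopology Y U2)" "snd r \<in> topspace (subtopology Y U2)"
      by (auto simp: W_def)
    have "a1 l (fst q) = a1 l (fst r)" if "l < d" for l
      using eq that by (auto simp: e_def dest: spec[of _ l])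
    moreover have "a2 l (snd q) = a2 l (snd r)" if "l < d" for l
    proof -
      have "e (l + d) q = e (l + d) r" using eq that by simp
      then show ?thesis by (simp add: e_def)
    qed
    ultimately have "fst q = fst r" "snd q = snd r"
      using U1(3) U2(3) qr unfolding real_coordinates_def by blast+
    then show "q = r" by (simp add: prod_eq_iff)
  qed
  ultimately show ?thesis by blast
qed

text \<open>The pairs \<open>(f x, f (-x))\<close> form a compact space with the swap as a free involution and with charts
  of dimension \<open>2 * d\<close>.  It therefore carries an odd family of \<open>2 * d + 1\<close> functions without common
  zero, and its pullback to the sphere contradicts the Borsuk-Ulam theorem.\<close>

theorem BUP_manifold_of_small_dimension:
  assumes Y: "topological_manifold d Y" and dim: "2 * d < M"
  shows "BUP (nsphere M) antipode Y"
  unfolding BUP_def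
proof (intro allI impI, rule ccontr)
  fix f assume f: "continuous_map (nsphere M) Y f"
    and no_coincidence: "\<not> (\<exists>x\<in>topspace (nsphere M). f (antipode x) = f x)"
  let ?S = "nsphere M" and ?YY = "prod_topology Y Y"
  have anti: "continuous_map ?S ?S antipode" "\<And>x. antipode (antipode x) = x"
    using free_involution_antipode[of M] by (auto simp: free_involution_def antipode_def)
  have anti_in: "antipode x \<in> topspace ?S" if "x \<in> topspace ?S" for x
    using anti(1) that by (auto simp: continuous_map_def)
  define g where "g x = (f x, f (antipode x))" for x
  have g: "continuous_map ?S ?YY g"
    unfolding g_def using continuous_map_compose[OF anti(1) f]
    by (intro continuous_map_pairedI f) (simp add: o_def)
  define K where "K = g ` topspace ?S"
  have "compactin ?YY K"
    unfolding K_def using compact_space_nsphere g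
    by (intro image_compactin) (simp_all add: compact_space_def)
  moreover have swap_g: "prod.swap (g x) = g (antipode x)" for x
    by (simp add: g_def anti)
  then have "prod.swap ` K \<subseteq> K" using anti_in by (auto simp: K_def)
  moreover have ne: "fst p \<noteq> snd p" if "p \<in> K" for p
    using that no_coincidence by (auto simp: K_def g_def)
  moreover have "Hausdorff_space Y" using Y by (simp add: topological_manifold_def)
  ultimately interpret compact_free_involution "subtopology ?YY K" prod.swap
    by (intro compact_free_involution_swap)
  have KYY: "K \<subseteq> topspace ?YY" using \<open>compactin ?YY K\<close> compactin_subset_topspace by blast
  then have topK: "topspace (subtopology ?YY K) = K" by auto
  have zero: "odd_family (subtopology ?YY K) prod.swap (2 * d + 1) (\<lambda>_ _. 0)"
    "nonvanishing_on (2 * d + 1) (\<lambda>_ _. 0) {}"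
    by (auto simp: odd_family_def nonvanishing_on_def)
  have clK: "closedin (subtopology ?YY K) K" using closedin_topspace[of "subtopology ?YY K"] topK by simp
  have lt: "d + d < 2 * d + 1" by simp
  obtain \<psi> where \<psi>: "odd_family (subtopology ?YY K) prod.swap (2 * d + 1) \<psi>"
    "nonvanishing_on (2 * d + 1) \<psi> ({} \<union> K)"
    by (rule odd_extension_over_charts[OF closedin_empty _ zero clK lt
          manifold_square_chart[OF Y _ KYY ne]]) (auto intro: that)
  have gK: "continuous_map ?S (subtopology ?YY K) g"
    using g by (auto simp: continuous_map_in_subtopology K_def)
  have "odd_family ?S antipode (2 * d + 1) (\<lambda>j x. \<psi> j (g x))"
    unfolding odd_family_def
  proof (intro allI impI conjI ballI)
    fix j assume j: "j < 2 * d + 1"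
    then show "continuous_map ?S euclideanreal (\<lambda>x. \<psi> j (g x))"
      using \<psi>(1) continuous_map_compose[OF gK, of euclideanreal "\<psi> j"]
      by (simp add: odd_family_def o_def)
    show "\<psi> j (g (antipode x)) = - \<psi> j (g x)" if "x \<in> topspace ?S" for x
      using \<psi>(1) j that unfolding odd_family_def topK swap_g[symmetric] by (simp add: K_def)
  qed
  moreover have "nonvanishing_on (2 * d + 1) (\<lambda>j x. \<psi> j (g x)) (topspace ?S)"
    using \<psi>(2) by (auto simp: nonvanishing_on_def K_def)
  ultimately show False using Borsuk_Ulam_odd_family dim by force
qed


section \<open>CW complexes\<close>

lemma compact_space_closed_disc: "compact_space (closed_disc n)"
proof -
  let ?S = "{x :: nat \<Rightarrow> real. (\<forall>i\<ge>n. x i = 0) \<and> (\<Sum>i<n. x i ^ 2) \<le> 1}"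
  have "closed_disc n = subtopology (powertop_real UNIV) ?S"
    by (simp add: closed_disc_def Euclidean_space_def subtopology_subtopology Collect_conj_eq)
  moreover have "compact_space (subtopology (powertop_real UNIV) ?S)"
  proof (rule compact_space_bounded_closed_coordinates)
    have "?S = {x. (\<Sum>i<n. (x i)\<^sup>2) \<in> {..1}} \<inter> (\<Inter>i. {x. (if i \<ge> n then x i else 0) \<in> {0}})"
      by auto
    moreover have "closedin (powertop_real UNIV) {x. (\<Sum>i<n. (x i)\<^sup>2) \<in> {..1}}"
      by (intro closedin_coordinate_equation continuous_intros continuous_map_product_projection) auto
    moreover have "closedin (powertop_real UNIV) {x. (if i \<ge> n then x i else 0) \<in> {0}}" for i
      by (intro closedin_coordinate_equation)
        (auto intro: continuous_map_product_projection)
    ultimately show "closedin (powertop_real UNIV) ?S"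
      by (metis (no_types, lifting) closedin_Int closedin_INT UNIV_not_empty)
    show "\<bar>x i\<bar> \<le> 1" if "x \<in> ?S" for x i
    proof (cases "i < n")
      case True
      then have "(x i)\<^sup>2 \<le> (\<Sum>i<n. (x i)\<^sup>2)" by (intro member_le_sum) auto
      also have "\<dots> \<le> 1" using that by simp
      finally show ?thesis by (simp add: abs_square_le_1)
    qed (use that in auto)
  qed
  ultimately show ?thesis by simp
qed

lemma topspace_closed_disc: "topspace (closed_disc n) = disc_interior n \<union> disc_boundary n"
  by (auto simp: closed_disc_def disc_interior_def disc_boundary_def)

context
  fixes X :: "'a topology" and E :: "nat \<Rightarrow> 'a set set"
  assumes CW: "CW_complex X E"
begin

lemma Hausdorff_CW: "Hausdorff_space X"
  using CW unfolding CW_complex_def by (rule conjunct1)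

lemma cells_cover: "(\<Union>n. \<Union>(E n)) = topspace X"
  using CW unfolding CW_complex_def by (elim conjE)

lemma cells_disjoint:
  assumes "d \<in> E m" "e \<in> E n" "x \<in> d" "x \<in> e"
  shows "m = n \<and> d = e"
proof -
  have "\<forall>m n. \<forall>d\<in>E m. \<forall>e\<in>E n. (m, d) \<noteq> (n, e) \<longrightarrow> d \<inter> e = {}"
    using CW unfolding CW_complex_def by (elim conjE)
  with assms have "(m, d) = (n, e)" by (metis IntI empty_iff)
  then show ?thesis by simp
qed

lemma ex_characteristic_map: "e \<in> E n \<Longrightarrow> \<exists>\<phi>. characteristic_map X E n e \<phi>"
proof -
  have "\<forall>n. \<forall>e\<in>E n. \<exists>\<phi>. characteristic_map X E n e \<phi>"
    using CW unfolding CW_complex_def by (elim conjE)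
  then show "e \<in> E n \<Longrightarrow> \<exists>\<phi>. characteristic_map X E n e \<phi>" by simp
qed

lemma weak_topology:
  assumes "A \<subseteq> topspace X" "\<And>n e. e \<in> E n \<Longrightarrow> closedin X (A \<inter> X closure_of e)"
  shows "closedin X A"
proof -
  have "\<forall>A\<subseteq>topspace X. (\<forall>n. \<forall>e\<in>E n. closedin X (A \<inter> X closure_of e)) \<longrightarrow> closedin X A"
    using CW unfolding CW_complex_def by (elim conjE)
  with assms show ?thesis by simp
qed

lemma cell_subset_topspace: "e \<in> E n \<Longrightarrow> e \<subseteq> topspace X"
  using cells_cover by blast

lemma characteristic_map_image:
  assumes "characteristic_map X E n e \<phi>" "e \<in> E n"
  shows "\<phi> ` disc_interior n = e"
proof -
  have "\<phi> ` topspace (subtopology (closed_disc n) (disc_interior n)) = topspace (subtopology X e)"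
    using assms(1) by (intro homeomorphic_imp_surjective_map) (simp add: characteristic_map_def)
  then show ?thesis
    using cell_subset_topspace[OF assms(2)] by (auto simp: topspace_closed_disc Int_absorb1 Int_commute)
qed

lemma cell_closure:
  assumes e: "e \<in> E n"
  obtains F where "finite F" "F \<subseteq> (\<Union>k<n. E k)" "X closure_of e \<subseteq> e \<union> \<Union>F"
proof -
  obtain \<phi> where \<phi>: "characteristic_map X E n e \<phi>" using ex_characteristic_map[OF e] by blast
  then obtain F where F: "finite F" "F \<subseteq> (\<Union>k<n. E k)" "\<phi> ` disc_boundary n \<subseteq> \<Union>F"
    by (auto simp: characteristic_map_def)
  have "compactin X (\<phi> ` topspace (closed_disc n))"
    using \<phi> compact_space_closed_disc[of n]
    by (intro image_compactin[of "closed_disc n"]) (auto simp: characteristic_map_def compact_space_def)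
  then have "closedin X (\<phi> ` topspace (closed_disc n))"
    using Hausdorff_CW compactin_imp_closedin by blast
  moreover have "e \<subseteq> \<phi> ` topspace (closed_disc n)"
    using characteristic_map_image[OF \<phi> e] by (auto simp: topspace_closed_disc)
  ultimately have "X closure_of e \<subseteq> \<phi> ` topspace (closed_disc n)" by (rule closure_of_minimal[rotated])
  also have "\<dots> \<subseteq> e \<union> \<Union>F"
    using characteristic_map_image[OF \<phi> e] F(3) by (auto simp: topspace_closed_disc)
  finally show thesis using that F by blast
qed

lemma cell_coordinates:
  assumes e: "e \<in> E n"
  obtains c where "real_coordinates (subtopology X e) n c"
proof -
  let ?D = "subtopology (closed_disc n) (disc_interior n)"
  obtain \<phi> where "characteristic_map X E n e \<phi>" using ex_characteristic_map[OF e] by blast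
  then obtain g where g: "homeomorphic_maps ?D (subtopology X e) \<phi> g"
    by (auto simp: characteristic_map_def homeomorphic_map_maps)
  then have cont: "continuous_map (subtopology X e) ?D g"
    and inv: "\<And>x. x \<in> topspace (subtopology X e) \<Longrightarrow> \<phi> (g x) = x"
    by (auto simp: homeomorphic_maps_def)
  have "real_coordinates (subtopology X e) n (\<lambda>l x. g x l)"
    unfolding real_coordinates_def
  proof (intro conjI allI ballI impI)
    show "continuous_map (subtopology X e) euclideanreal (\<lambda>x. g x l)" for l
      using cont by (simp add: closed_disc_def Euclidean_space_def continuous_map_in_subtopology
          continuous_map_componentwise_UNIV)
    fix x y assume xy: "x \<in> topspace (subtopology X e)" "y \<in> topspace (subtopology X e)"
      and eq: "\<forall>l<n. g x l = g y l"
    have "g x \<in> topspace ?D" "g y \<in> topspace ?D"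
      using xy cont unfolding continuous_map_def by blast+
    then have "g x l = g y l" for l
      using eq by (cases "l < n") (auto simp: closed_disc_def topspace_Euclidean_space)
    then have "g x = g y" by (simp add: fun_eq_iff)
    then show "x = y" using inv xy by metis
  qed
  then show thesis using that by blast
qed

text \<open>Choose a point in every cell that meets \<open>Q\<close>.  The closure of a cell meets only finitely many
  cells, so by the weak topology every set of chosen points is closed.  Hence the chosen points cannot
  accumulate, and in the compact set \<open>Q\<close> there are only finitely many of them.\<close>

lemma compact_meets_finitely_many_cells:
  assumes Q: "compactin X Q"
  shows "finite {(n, e). e \<in> E n \<and> e \<inter> Q \<noteq> {}}" (is "finite ?S")
proof (rule ccontr)
  assume inf: "infinite ?S"
  have "\<forall>p\<in>?S. \<exists>x. x \<in> snd p \<inter> Q" by auto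
  then obtain t where t: "\<And>p. p \<in> ?S \<Longrightarrow> t p \<in> snd p \<inter> Q"
    using bchoice[of ?S "\<lambda>p x. x \<in> snd p \<inter> Q"] by blast
  define T where "T = t ` ?S"
  have TQ: "T \<subseteq> Q" using t by (auto simp: T_def)
  have TX: "T \<subseteq> topspace X" using TQ compactin_subset_topspace[OF Q] by blast
  have "inj_on t ?S"
  proof (rule inj_onI)
    fix p p' assume p: "p \<in> ?S" "p' \<in> ?S" "t p = t p'"
    then have "t p \<in> snd p" "t p \<in> snd p'" using t[of p] t[of p'] by auto
    then show "p = p'" using p(1,2) cells_disjoint[of "snd p" "fst p" "snd p'" "fst p'" "t p"]
      by (auto simp: prod_eq_iff)
  qed
  then have "infinite T" using inf finite_imageD unfolding T_def by blast
  have one: "finite (T \<inter> e)" if e: "e \<in> E n" for n e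
  proof -
    have "T \<inter> e \<subseteq> {t (n, e)}"
    proof
      fix x assume x: "x \<in> T \<inter> e"
      then obtain p where p: "p \<in> ?S" "x = t p" by (auto simp: T_def)
      then have "x \<in> snd p" using t[of p] by auto
      then have "p = (n, e)"
        using p x cells_disjoint[of "snd p" "fst p" e n x] e by (auto simp: prod_eq_iff)
      then show "x \<in> {t (n, e)}" using p by simp
    qed
    then show ?thesis by (rule finite_subset) simp
  qed
  have closed: "closedin X T'" if "T' \<subseteq> T" for T'
  proof (rule weak_topology)
    show "T' \<subseteq> topspace X" using that TX by blast
    fix n e assume e: "e \<in> E n"
    obtain F where F: "finite F" "F \<subseteq> (\<Union>k<n. E k)" "X closure_of e \<subseteq> e \<union> \<Union>F"
      using cell_closure[OF e] .
    have "finite (T \<inter> f)" if f: "f \<in> F" for f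
    proof -
      obtain k where "f \<in> E k" using f F(2) by blast
      then show ?thesis by (rule one)
    qed
    then have "finite ((T \<inter> e) \<union> (\<Union>f\<in>F. T \<inter> f))"
      by (intro finite_UnI finite_UN_I one[OF e] F(1))
    moreover have "T' \<inter> X closure_of e \<subseteq> (T \<inter> e) \<union> (\<Union>f\<in>F. T \<inter> f)" using F(3) that by auto
    ultimately have "finite (T' \<inter> X closure_of e)" by (rule finite_subset[rotated])
    then show "closedin X (T' \<inter> X closure_of e)"
      using that TX by (intro closedin_Hausdorff_finite[OF Hausdorff_CW]) auto
  qed
  have "Q \<inter> X derived_set_of T \<noteq> {}"
    using compactin_imp_Bolzano_Weierstrass[OF Q] \<open>infinite T\<close> TQ by blast
  then obtain x where x: "x \<in> X derived_set_of T" by blast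
  have "openin X (topspace X - (T - {x}))" using closed by blast
  moreover have "x \<in> topspace X - (T - {x})" using x by (auto simp: in_derived_set_of)
  ultimately obtain y where "y \<noteq> x" "y \<in> T" "y \<in> topspace X - (T - {x})"
    using x unfolding in_derived_set_of by meson
  then show False by blast
qed

text \<open>Closures are required to add only cells of strictly lower dimension.  A cell of top dimension can
  then be removed without destroying the condition, which is what the induction below needs.\<close>

definition finite_subcomplex :: "(nat \<times> 'a set) set \<Rightarrow> bool" where
  "finite_subcomplex S \<longleftrightarrow> finite S \<and>
    (\<forall>(n, e)\<in>S. e \<in> E n \<and> X closure_of e \<subseteq> e \<union> \<Union>{f. \<exists>k<n. (k, f) \<in> S})"

lemma finite_subcomplexD:
  assumes "finite_subcomplex S" "p \<in> S"
  shows "snd p \<in> E (fst p)"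
    "(X closure_of (snd p)) \<subseteq> snd p \<union> \<Union>{f. \<exists>k<fst p. (k, f) \<in> S}"
proof -
  have "case p of (n, e) \<Rightarrow> e \<in> E n \<and> X closure_of e \<subseteq> e \<union> \<Union>{f. \<exists>k<n. (k, f) \<in> S}"
    using assms unfolding finite_subcomplex_def by (elim conjE) (rule bspec)
  then show "snd p \<in> E (fst p)"
    "(X closure_of (snd p)) \<subseteq> snd p \<union> \<Union>{f. \<exists>k<fst p. (k, f) \<in> S}"
    by (simp_all add: case_prod_beta)
qed

lemma finite_subcomplex_Union:
  assumes "finite \<S>" "\<And>S. S \<in> \<S> \<Longrightarrow> finite_subcomplex S"
  shows "finite_subcomplex (\<Union>\<S>)"
  unfolding finite_subcomplex_def
proof (intro conjI ballI, goal_cases)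
  case 1
  then show ?case using assms by (auto simp: finite_subcomplex_def)
next
  case (2 p)
  then obtain S where S: "S \<in> \<S>" "p \<in> S" by blast
  obtain n e where p: "p = (n, e)" by (cases p)
  have "e \<in> E n" "X closure_of e \<subseteq> e \<union> \<Union>{f. \<exists>k<n. (k, f) \<in> S}"
    using assms(2)[OF S(1)] S(2) p by (auto simp: finite_subcomplex_def)
  moreover have "\<Union>{f. \<exists>k<n. (k, f) \<in> S} \<subseteq> \<Union>{f. \<exists>k<n. (k, f) \<in> \<Union>\<S>}" using S(1) by blast
  ultimately show ?case using p by auto
qed

lemma cell_in_finite_subcomplex:
  assumes "e \<in> E n"
  shows "\<exists>S. finite_subcomplex S \<and> (n, e) \<in> S"
  using assms
proof (induction n arbitrary: e rule: less_induct)
  case (less n)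
  obtain F where F: "finite F" "F \<subseteq> (\<Union>k<n. E k)" "X closure_of e \<subseteq> e \<union> \<Union>F"
    using cell_closure[OF less.prems] .
  have "\<forall>f\<in>F. \<exists>S. finite_subcomplex S \<and> (\<exists>k<n. (k, f) \<in> S)"
    using F(2) less.IH by blast
  then obtain S where S: "\<forall>f\<in>F. finite_subcomplex (S f) \<and> (\<exists>k<n. (k, f) \<in> S f)"
    using bchoice[of F "\<lambda>f S. finite_subcomplex S \<and> (\<exists>k<n. (k, f) \<in> S)"] by blast
  define S' where "S' = \<Union>(S ` F)"
  have S': "finite_subcomplex S'"
    unfolding S'_def using F(1) S by (intro finite_subcomplex_Union) auto
  have "\<Union>F \<subseteq> \<Union>{f. \<exists>k<n. (k, f) \<in> S'}"
  proof (rule Union_mono, rule subsetI, rule CollectI)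
    fix f assume f: "f \<in> F"
    then obtain k where "k < n" "(k, f) \<in> S f" using S by blast
    with f show "\<exists>k<n. (k, f) \<in> S'" by (auto simp: S'_def)
  qed
  have mono: "\<Union>{f. \<exists>k<j. (k, f) \<in> S'} \<subseteq> \<Union>{f. \<exists>k<j. (k, f) \<in> insert (n, e) S'}" for j
    by (rule Union_mono) auto
  note F(3)
  also have "e \<union> \<Union>F \<subseteq> e \<union> \<Union>{f. \<exists>k<n. (k, f) \<in> insert (n, e) S'}"
    by (intro Un_mono order_refl order_trans[OF \<open>\<Union>F \<subseteq> _\<close> mono])
  finally have e: "X closure_of e \<subseteq> e \<union> \<Union>{f. \<exists>k<n. (k, f) \<in> insert (n, e) S'}" .
  have "finite_subcomplex (insert (n, e) S')"
    unfolding finite_subcomplex_def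
  proof (intro conjI ballI)
    show "finite (insert (n, e) S')" using S' by (simp add: finite_subcomplex_def)
    fix p assume p: "p \<in> insert (n, e) S'"
    show "case p of (n', e') \<Rightarrow> e' \<in> E n' \<and>
      X closure_of e' \<subseteq> e' \<union> \<Union>{f. \<exists>k<n'. (k, f) \<in> insert (n, e) S'}"
    proof (cases "p = (n, e)")
      case True
      then show ?thesis using e less.prems by simp
    next
      case False
      obtain n' e' where p': "p = (n', e')" by (cases p)
      then have "(n', e') \<in> S'" using p False by auto
      then have "e' \<in> E n'" "X closure_of e' \<subseteq> e' \<union> \<Union>{f. \<exists>k<n'. (k, f) \<in> S'}"
        using S' by (auto simp: finite_subcomplex_def)
      moreover have "e' \<union> \<Union>{f. \<exists>k<n'. (k, f) \<in> S'}
          \<subseteq> e' \<union> \<Union>{f. \<exists>k<n'. (k, f) \<in> insert (n, e) S'}"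
        by (intro Un_mono order_refl mono)
      ultimately show ?thesis unfolding p' prod.case by (meson order_trans)
    qed
  qed
  then show ?case by blast
qed

lemma compact_in_finite_subcomplex:
  assumes Q: "compactin X Q"
  obtains S where "finite_subcomplex S" "Q \<subseteq> \<Union>(snd ` S)"
proof -
  let ?P = "{(n, e). e \<in> E n \<and> e \<inter> Q \<noteq> {}}"
  have "\<forall>p\<in>?P. \<exists>S. finite_subcomplex S \<and> p \<in> S" using cell_in_finite_subcomplex by auto
  then obtain S where S: "\<forall>p\<in>?P. finite_subcomplex (S p) \<and> p \<in> S p"
    using bchoice[of ?P "\<lambda>p S. finite_subcomplex S \<and> p \<in> S"] by blast
  show thesis
  proof (rule that)
    show "finite_subcomplex (\<Union>(S ` ?P))"
      using compact_meets_finitely_many_cells[OF Q] S by (intro finite_subcomplex_Union) auto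
    show "Q \<subseteq> \<Union>(snd ` \<Union>(S ` ?P))"
    proof
      fix x assume x: "x \<in> Q"
      then obtain n e where e: "e \<in> E n" "x \<in> e"
        using cells_cover compactin_subset_topspace[OF Q] by blast
      then have "(n, e) \<in> ?P" using x by auto
      then have "(n, e) \<in> \<Union>(S ` ?P)" using S by blast
      then show "x \<in> \<Union>(snd ` \<Union>(S ` ?P))" using e(2) by force
    qed
  qed
qed

lemma closedin_finite_subcomplex:
  assumes "finite_subcomplex S"
  shows "closedin X (\<Union>(snd ` S))"
proof -
  have "\<Union>(snd ` S) = (\<Union>p\<in>S. X closure_of (snd p))"
  proof (rule antisym)
    have "snd p \<subseteq> (X closure_of (snd p))" if "p \<in> S" for p
      by (intro closure_of_subset cell_subset_topspace[OF finite_subcomplexD(1)[OF assms that]])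
    then show "\<Union>(snd ` S) \<subseteq> (\<Union>p\<in>S. X closure_of (snd p))" by (intro UN_mono order_refl)
    show "(\<Union>p\<in>S. X closure_of (snd p)) \<subseteq> \<Union>(snd ` S)"
    proof (rule UN_least)
    fix p assume p: "p \<in> S"
    note finite_subcomplexD(2)[OF assms p]
    also have "snd p \<union> \<Union>{f. \<exists>k<fst p. (k, f) \<in> S} \<subseteq> \<Union>(snd ` S)" using p by force
    finally show "(X closure_of (snd p)) \<subseteq> \<Union>(snd ` S)" .
    qed
  qed
  moreover have "closedin X (\<Union>p\<in>S. X closure_of (snd p))"
    using assms by (intro closedin_Union) (auto simp: finite_subcomplex_def)
  ultimately show ?thesis by simp
qed

lemma finite_subcomplex_remove_top_cell:
  assumes S: "finite_subcomplex S" "(n, e) \<in> S" "\<And>k f. (k, f) \<in> S \<Longrightarrow> k \<le> n"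
  shows "finite_subcomplex (S - {(n, e)})"
  unfolding finite_subcomplex_def
proof (intro conjI ballI)
  show "finite (S - {(n, e)})" using S by (simp add: finite_subcomplex_def)
  fix p assume p: "p \<in> S - {(n, e)}"
  obtain n' e' where p': "p = (n', e')" by (cases p)
  then have "n' \<le> n" using p S(3) by blast
  then have "{f. \<exists>k<n'. (k, f) \<in> S - {(n, e)}} = {f. \<exists>k<n'. (k, f) \<in> S}" by auto
  then show "case p of (n', e') \<Rightarrow> e' \<in> E n' \<and>
      X closure_of e' \<subseteq> e' \<union> \<Union>{f. \<exists>k<n'. (k, f) \<in> S - {(n, e)}}"
    using S(1) p p' by (auto simp: finite_subcomplex_def)
qed

text \<open>The image of \<open>Z\<close> lies in a finite subcomplex.  Adding its cells in order of dimension, the part of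
  \<open>Z\<close> over a new cell of dimension \<open>n < N\<close> inherits \<open>n\<close> coordinates from the cell, injective up to
  \<open>\<sigma>\<close> because \<open>q\<close> identifies only the points of an orbit.\<close>

theorem odd_family_over_CW_complex:
  fixes Z :: "'c topology"
  assumes Z: "compact_free_involution Z \<sigma>" and q: "continuous_map Z X q"
    and inv: "\<And>z. z \<in> topspace Z \<Longrightarrow> q (\<sigma> z) = q z"
    and fibres: "\<And>z z'. \<lbrakk>z \<in> topspace Z; z' \<in> topspace Z; q z = q z'\<rbrakk> \<Longrightarrow> z' = z \<or> z' = \<sigma> z"
    and dim: "\<And>n. E n \<noteq> {} \<Longrightarrow> n < N"
  obtains \<psi> where "odd_family Z \<sigma> N \<psi>" "nonvanishing_on N \<psi> (topspace Z)"
proof -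
  interpret compact_free_involution Z \<sigma> by (rule Z)
  define over where "over P = {z \<in> topspace Z. q z \<in> P}" for P
  have over_inv: "\<sigma> ` over P \<subseteq> over P" for P using inv by (auto simp: over_def)
  have "compactin X (q ` topspace Z)"
    using q compact_Z by (intro image_compactin[of Z]) (auto simp: compact_space_def)
  then obtain S where S: "finite_subcomplex S" "q ` topspace Z \<subseteq> \<Union>(snd ` S)"
    using compact_in_finite_subcomplex by blast
  have closed: "closedin Z (over (\<Union>(snd ` S)))" if "finite_subcomplex S" for S
    unfolding over_def using closedin_continuous_map_preimage[OF q closedin_finite_subcomplex[OF that]] .
  have "\<exists>\<psi>. odd_family Z \<sigma> N \<psi> \<and> nonvanishing_on N \<psi> (over (\<Union>(snd ` S)))"
    using S(1)
  proof (induction S rule: measure_induct_rule[of card])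
    case (less S)
    show ?case
    proof (cases "S = {}")
      case True
      have "odd_family Z \<sigma> N (\<lambda>_ _. 0)" by (simp add: odd_family_def)
      then show ?thesis using True by (auto simp: nonvanishing_on_def over_def)
    next
      case False
      have fin: "finite S" using less.prems by (simp add: finite_subcomplex_def)
      define n where "n = Max (fst ` S)"
      have "n \<in> fst ` S" unfolding n_def using fin False by (intro Max_in) auto
      then obtain e where ne: "(n, e) \<in> S" by auto
      have max: "k \<le> n" if "(k, f) \<in> S" for k f
        unfolding n_def using fin that by (intro Max_ge) force+
      define S' where "S' = S - {(n, e)}"
      have S': "finite_subcomplex S'"
        unfolding S'_def using finite_subcomplex_remove_top_cell[OF less.prems ne max] .
      moreover have "card S' < card S" unfolding S'_def using fin ne by (rule card_Diff1_less)
      ultimately obtain \<psi> where \<psi>: "odd_family Z \<sigma> N \<psi>" "nonvanishing_on N \<psi> (over (\<Union>(snd ` S')))"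
        using less.IH by blast
      have e: "e \<in> E n" using less.prems ne by (auto simp: finite_subcomplex_def)
      obtain c where c: "real_coordinates (subtopology X e) n c" using cell_coordinates[OF e] .
      have "S = insert (n, e) S'" using ne by (auto simp: S'_def)
      then have eq: "over (\<Union>(snd ` S)) = over (\<Union>(snd ` S')) \<union> over e"
        by (auto simp: over_def)
      have "n < N" using dim e by blast
      have qe: "continuous_map (subtopology Z (over e)) (subtopology X e) q"
        using q by (auto simp: continuous_map_in_subtopology continuous_map_from_subtopology over_def)
      have cl: "closedin Z (over (\<Union>(snd ` S')) \<union> over e)" using closed[OF less.prems] eq by simp
      obtain \<psi>' where "odd_family Z \<sigma> N \<psi>'" "nonvanishing_on N \<psi>' (over (\<Union>(snd ` S')) \<union> over e)"
      proof (rule odd_extension_over_stratum[OF closed[OF S'] over_inv \<psi> cl over_inv \<open>n < N\<close>,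
            where e = "\<lambda>l z. c l (q z)"])
        show "continuous_map (subtopology Z (over e)) euclideanreal (\<lambda>z. c l (q z))" if "l < n" for l
          using continuous_map_compose[OF qe, of euclideanreal "c l"] c that
          by (simp add: real_coordinates_def o_def)
        fix z z' assume z: "z \<in> over e" "z' \<in> over e" "\<forall>l<n. c l (q z) = c l (q z')"
        then have "q z \<in> topspace (subtopology X e)" "q z' \<in> topspace (subtopology X e)"
          using cell_subset_topspace[OF e] by (auto simp: over_def)
        then have "q z = q z'" using c z(3) by (auto simp: real_coordinates_def)
        then show "z' = z \<or> z' = \<sigma> z" using fibres z by (simp add: over_def)
      qed (rule that; assumption)
      then show ?thesis using eq by auto
    qed
  qed
  moreover have "over (\<Union>(snd ` S)) = topspace Z" using S(2) by (auto simp: over_def)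
  ultimately show thesis using that by auto
qed

end


section \<open>Carrying odd maps along a homotopy\<close>

text \<open>The vector \<open>a z\<close>, indexed by \<open>B\<close>, is nonzero and spans a line.  It may jump between opposite signs;
  only the products of its components, which determine the line, are assumed continuous.  An odd
  continuous section \<open>u\<close> without zeros of this line field is given at time \<open>1\<close>.  For a time \<open>t'\<close> close
  to \<open>t\<close> the lines at \<open>t\<close> and \<open>t'\<close> are nowhere orthogonal, so the matrix of products
  \<open>a b z * a b' z\<close>, a multiple of the orthogonal projection onto the line, carries sections without
  zeros at time \<open>t\<close> to such sections at time \<open>t'\<close>.  As the interval is connected, one reaches time
  \<open>0\<close>.\<close>

lemma line_field_transport:
  fixes a :: "'b \<Rightarrow> real \<times> 'x \<Rightarrow> real" and u :: "'b \<Rightarrow> 'x \<Rightarrow> real"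
  defines "I \<equiv> top_of_set {0..1::real}"
  assumes "finite B" and X: "compact_space X" and \<alpha>: "\<And>x. x \<in> topspace X \<Longrightarrow> \<alpha> x \<in> topspace X"
    and cont: "\<And>b b'. \<lbrakk>b \<in> B; b' \<in> B\<rbrakk>
        \<Longrightarrow> continuous_map (prod_topology I X) euclideanreal (\<lambda>z. a b z * a b' z)"
    and nonzero: "\<And>t x. \<lbrakk>t \<in> {0..1}; x \<in> topspace X\<rbrakk> \<Longrightarrow> \<exists>b\<in>B. a b (t, x) \<noteq> 0"
    and invariant: "\<And>b t x. \<lbrakk>b \<in> B; x \<in> topspace X\<rbrakk> \<Longrightarrow> a b (t, \<alpha> x) = a b (t, x)"
    and u: "\<And>b. b \<in> B \<Longrightarrow> continuous_map X euclideanreal (u b)"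
      "\<And>b x. \<lbrakk>b \<in> B; x \<in> topspace X\<rbrakk> \<Longrightarrow> u b (\<alpha> x) = - u b x"
      "\<And>x. x \<in> topspace X \<Longrightarrow> \<exists>c. c \<noteq> 0 \<and> (\<forall>b\<in>B. u b x = c * a b (1, x))"
  obtains v where "\<And>b. b \<in> B \<Longrightarrow> continuous_map X euclideanreal (v b)"
    "\<And>b x. \<lbrakk>b \<in> B; x \<in> topspace X\<rbrakk> \<Longrightarrow> v b (\<alpha> x) = - v b x"
    "\<And>x. x \<in> topspace X \<Longrightarrow> \<exists>c. c \<noteq> 0 \<and> (\<forall>b\<in>B. v b x = c * a b (0, x))"
proof -
  define odd_frame where "odd_frame t v \<longleftrightarrow>
      (\<forall>b\<in>B. continuous_map X euclideanreal (v b)) \<and>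
      (\<forall>b\<in>B. \<forall>x\<in>topspace X. v b (\<alpha> x) = - v b x) \<and>
      (\<forall>x\<in>topspace X. \<exists>c. c \<noteq> 0 \<and> (\<forall>b\<in>B. v b x = c * a b (t, x)))"
    for t :: real and v :: "'b \<Rightarrow> 'x \<Rightarrow> real"
  have slice: "continuous_map X euclideanreal (\<lambda>x. a b (t, x) * a b' (t, x))"
    if "t \<in> {0..1}" "b \<in> B" "b' \<in> B" for t b b'
  proof -
    have "continuous_map X (prod_topology I X) (\<lambda>x. (t, x))"
      using that(1) by (intro continuous_map_pairedI) (simp_all add: I_def)
    then show ?thesis using continuous_map_compose[OF _ cont[OF that(2,3)]] by (simp add: o_def)
  qed
  define ip where "ip t t' x = (\<Sum>b\<in>B. a b (t, x) * a b (t', x))" for t t' x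
  have ip_sym: "ip t t' x = ip t' t x" for t t' x by (simp add: ip_def mult.commute)
  have move: "\<exists>v. odd_frame t' v"
    if v: "odd_frame t v" and t': "t' \<in> {0..1}" and ip: "\<And>x. x \<in> topspace X \<Longrightarrow> ip t t' x \<noteq> 0"
    for t t' v
  proof
    let ?w = "\<lambda>b x. \<Sum>b'\<in>B. (a b (t', x) * a b' (t', x)) * v b' x"
    have "\<exists>c. c \<noteq> 0 \<and> (\<forall>b\<in>B. ?w b x = c * a b (t', x))" if x: "x \<in> topspace X" for x
    proof -
      obtain c where c: "c \<noteq> 0" "\<forall>b\<in>B. v b x = c * a b (t, x)"
        using v x unfolding odd_frame_def by blast
      have "?w b x = (c * ip t t' x) * a b (t', x)" for b
      proof -
        have "?w b x = (\<Sum>b'\<in>B. (c * a b (t', x)) * (a b' (t, x) * a b' (t', x)))"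
          using c(2) by (intro sum.cong) auto
        then show ?thesis by (simp add: ip_def sum_distrib_left mult_ac)
      qed
      then show ?thesis using c(1) ip[OF x] by (intro exI[of _ "c * ip t t' x"]) auto
    qed
    moreover have "continuous_map X euclideanreal (?w b)" if "b \<in> B" for b
      using v t' that \<open>finite B\<close> unfolding odd_frame_def
      by (intro continuous_map_sum continuous_map_real_mult slice) auto
    moreover have "?w b (\<alpha> x) = - ?w b x" if "b \<in> B" "x \<in> topspace X" for b x
      using v that invariant unfolding odd_frame_def
      by (auto simp: sum_negf[symmetric] intro!: sum.cong)
    ultimately show "odd_frame t' ?w" unfolding odd_frame_def by blast
  qed
  have "\<exists>v. odd_frame 0 v"
  proof (rule connected_induction_simple[of "{0..1::real}" 1 0 "\<lambda>t. \<exists>v. odd_frame t v"])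
    show "connected {0..1::real}" by simp
    show "\<exists>v. odd_frame 1 v" using u by (intro exI[of _ u]) (simp add: odd_frame_def)
    fix s :: real assume s: "s \<in> {0..1}"
    \<comment> \<open>The double sum is the square of the inner product of the vectors at times \<open>s\<close> and \<open>t\<close>, expressed
      through the products that are known to be continuous.\<close>
    define W where "W = {z \<in> topspace (prod_topology I X).
      (\<Sum>b\<in>B. \<Sum>b'\<in>B. (a b (s, snd z) * a b' (s, snd z)) * (a b z * a b' z)) \<in> {0<..}}"
    have sq: "(\<Sum>b\<in>B. \<Sum>b'\<in>B. (a b (s, x) * a b' (s, x)) * (a b (t, x) * a b' (t, x))) = (ip s t x)\<^sup>2"
      for t x by (simp add: ip_def power2_eq_square sum_product mult_ac)
    have "openin (prod_topology I X) W"
      unfolding W_def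
    proof (rule openin_continuous_map_preimage[where Y = euclideanreal])
      have "continuous_map (prod_topology I X) euclideanreal (\<lambda>z. a b (s, snd z) * a b' (s, snd z))"
        if "b \<in> B" "b' \<in> B" for b b'
        using continuous_map_compose[OF continuous_map_snd slice[OF s that]] by (simp add: o_def)
      then have "continuous_map (prod_topology I X) euclideanreal
          (\<lambda>z. (a b (s, snd z) * a b' (s, snd z)) * (a b z * a b' z))"
        if "b \<in> B" "b' \<in> B" for b b'
        using that by (intro continuous_map_real_mult[OF _ cont])
      then show "continuous_map (prod_topology I X) euclideanreal
         (\<lambda>z. \<Sum>b\<in>B. \<Sum>b'\<in>B. (a b (s, snd z) * a b' (s, snd z)) * (a b z * a b' z))"
        using \<open>finite B\<close> by (intro continuous_map_sum)
    qed auto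
    moreover have "{s} \<times> topspace X \<subseteq> W"
    proof clarify
      fix x assume x: "x \<in> topspace X"
      obtain b where b: "b \<in> B" "a b (s, x) \<noteq> 0" using nonzero[OF s x] by blast
      have "0 < (a b (s, x))\<^sup>2" using b by simp
      also have "\<dots> \<le> (\<Sum>b\<in>B. (a b (s, x))\<^sup>2)" using b \<open>finite B\<close> by (intro member_le_sum) auto
      finally have "0 < ip s s x" by (simp add: ip_def power2_eq_square)
      then show "(s, x) \<in> W" using x s sq[of x s] by (auto simp: W_def I_def)
    qed
    moreover have "s \<in> topspace I" using s by (simp add: I_def)
    ultimately obtain U V where UV: "openin I U" "s \<in> U" "topspace X \<subseteq> V" "U \<times> V \<subseteq> W"
      using tube_lemma_right[of I X W "topspace X" s] X by (auto simp: compact_space_def)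
    have ip_U: "ip s t x \<noteq> 0" if "t \<in> U" "x \<in> topspace X" for t x
    proof -
      have "(t, x) \<in> W" using that UV(3,4) by blast
      then show ?thesis using sq[of x t] by (auto simp: W_def)
    qed
    have U01: "t \<in> {0..1}" if "t \<in> U" for t
      using openin_subset[OF UV(1)] that by (auto simp: I_def)
    have "\<exists>v. odd_frame t' v" if t: "t \<in> U" and t': "t' \<in> U" and v: "odd_frame t v" for t t' v
    proof -
      have "ip t s x \<noteq> 0" if "x \<in> topspace X" for x
        using ip_U[OF t that] ip_sym[of t s x] by simp
      then obtain w where "odd_frame s w" using move[OF v s] by blast
      then show ?thesis using move[OF _ U01[OF t'] ip_U[OF t']] by blast
    qed
    then show "\<exists>T. openin (top_of_set {0..1}) T \<and> s \<in> T \<and>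
        (\<forall>x\<in>T. \<forall>y\<in>T. (\<exists>v. odd_frame x v) \<longrightarrow> (\<exists>v. odd_frame y v))"
      using UV(1,2) unfolding I_def by blast
  qed auto
  then obtain v where "odd_frame 0 v" by blast
  then show thesis using that[of v] unfolding odd_frame_def by blast
qed


section \<open>Unordered pairs of points\<close>

context
  fixes Y :: "'a topology"
  assumes Hausdorff_Y: "Hausdorff_space Y" and regular_Y: "completely_regular_space Y"
begin

abbreviation (input) "ordered_pairs \<equiv> ordered_config2 Y"
abbreviation (input) "unordered_pairs \<equiv> unordered_config2 Y"
abbreviation (input) "forget_order \<equiv> \<lambda>p :: 'a \<times> 'a. {p, prod.swap p}"

lemma topspace_ordered_pairs: "p \<in> topspace ordered_pairs \<longleftrightarrow> fst p \<in> topspace Y \<and> snd p \<in> topspace Y \<and> fst p \<noteq> snd p"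
  by (cases p) (auto simp: ordered_config2_def)

lemma forget_order_eq_iff: "forget_order p = forget_order p' \<longleftrightarrow> p' = p \<or> p' = prod.swap p"
  by (auto simp: doubleton_eq_iff)

lemma quotient_map_forget_order: "quotient_map ordered_pairs unordered_pairs forget_order"
  unfolding unordered_config2_def by (rule quotient_map_quotient_topology)

lemma Hausdorff_ordered_pairs: "Hausdorff_space ordered_pairs"
  unfolding ordered_config2_def
  by (simp add: Hausdorff_Y Hausdorff_space_subtopology Hausdorff_space_prod_topology)

lemma continuous_map_swap_ordered_pairs: "continuous_map ordered_pairs ordered_pairs prod.swap"
proof -
  have "continuous_map (prod_topology Y Y) (prod_topology Y Y) prod.swap"
    unfolding prod.swap_def
    by (intro continuous_map_pairedI continuous_map_fst continuous_map_snd)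
  then show ?thesis
    unfolding ordered_config2_def
    by (auto simp: continuous_map_in_subtopology continuous_map_from_subtopology)
qed

lemma perfect_map_forget_order: "perfect_map ordered_pairs unordered_pairs forget_order"
proof -
  have q: "continuous_map ordered_pairs unordered_pairs forget_order" "forget_order ` topspace ordered_pairs = topspace unordered_pairs"
    using quotient_map_forget_order quotient_imp_continuous_map quotient_imp_surjective_map by blast+
  have "closed_map ordered_pairs unordered_pairs forget_order"
    unfolding closed_map_def
  proof (intro allI impI)
    fix C assume C: "closedin ordered_pairs C"
    have CF: "C \<subseteq> topspace ordered_pairs" using C by (rule closedin_subset)
    have "{p \<in> topspace ordered_pairs. forget_order p \<notin> forget_order ` C}
      = topspace ordered_pairs - (C \<union> {p \<in> topspace ordered_pairs. prod.swap p \<in> C})"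
      using CF by (auto simp: forget_order_eq_iff image_iff)
    moreover have "closedin ordered_pairs (C \<union> {p \<in> topspace ordered_pairs. prod.swap p \<in> C})"
      using C closedin_continuous_map_preimage[OF continuous_map_swap_ordered_pairs C] by blast
    ultimately have "openin ordered_pairs {p \<in> topspace ordered_pairs. forget_order p \<in> topspace unordered_pairs - forget_order ` C}"
      using q by (auto simp: closedin_def) (smt (verit, best) Collect_cong image_eqI)
    then have "openin unordered_pairs (topspace unordered_pairs - forget_order ` C)"
      using quotient_map_forget_order unfolding quotient_map_def by blast
    then show "closedin unordered_pairs (forget_order ` C)" using CF q by (auto simp: closedin_def)
  qed
  moreover have "compactin ordered_pairs {p \<in> topspace ordered_pairs. forget_order p = y}" for y
  proof (rule finite_imp_compactin)
    show "finite {p \<in> topspace ordered_pairs. forget_order p = y}"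
    proof (cases "\<exists>p. forget_order p = y")
      case True
      then obtain p where "forget_order p = y" by blast
      then have "{p \<in> topspace ordered_pairs. forget_order p = y} \<subseteq> {p, prod.swap p}"
        by (auto simp: forget_order_eq_iff)
      then show ?thesis by (rule finite_subset) simp
    next
      case False
      then have "{p \<in> topspace ordered_pairs. forget_order p = y} = {}" by blast
      then show ?thesis by (metis finite.emptyI)
    qed
  qed auto
  ultimately show ?thesis using q by (simp add: perfect_map_def proper_map_def)
qed

lemma Hausdorff_unordered_pairs: "Hausdorff_space unordered_pairs"
proof (rule regular_t1_imp_Hausdorff_space)
  have "regular_space Y" using regular_Y by (rule completely_regular_imp_regular_space)
  then have "regular_space ordered_pairs"
    unfolding ordered_config2_def
    by (intro regular_space_subtopology) (simp add: regular_space_prod_topology)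
  then show "regular_space unordered_pairs" using regular_space_perfect_map_image perfect_map_forget_order by blast
  show "t1_space unordered_pairs"
    unfolding t1_space_closedin_singleton
  proof
    fix y assume "y \<in> topspace unordered_pairs"
    then obtain p where p: "p \<in> topspace ordered_pairs" "y = forget_order p"
      using quotient_imp_surjective_map[OF quotient_map_forget_order] by blast
    have "closedin ordered_pairs {p}" using Hausdorff_ordered_pairs p by (simp add: closedin_Hausdorff_singleton)
    then have "closedin unordered_pairs (forget_order ` {p})"
      using perfect_map_forget_order by (auto simp: perfect_map_def proper_map_def closed_map_def)
    then show "closedin unordered_pairs {y}" using p by simp
  qed
qed

text \<open>The differences \<open>b (fst p) - b (snd p)\<close> change sign under the swap and have no common zero on
  \<open>C\<close>.  They turn the double cover of the unordered pairs into a line field as in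
  \<open>line_field_transport\<close>.\<close>

lemma finite_separating_family:
  assumes C: "compactin ordered_pairs C"
  obtains B :: "('a \<Rightarrow> real) set" where "finite B" "\<And>b. b \<in> B \<Longrightarrow> continuous_map Y euclideanreal b"
    "\<And>p. p \<in> C \<Longrightarrow> \<exists>b\<in>B. b (fst p) \<noteq> b (snd p)"
proof -
  have CF: "C \<subseteq> topspace ordered_pairs" using C compactin_subset_topspace by blast
  have "\<exists>b. continuous_map Y euclideanreal b \<and> b (fst p) \<noteq> b (snd p)" if "p \<in> C" for p
  proof -
    have p: "fst p \<in> topspace Y" "snd p \<in> topspace Y" "fst p \<noteq> snd p"
      using that CF topspace_ordered_pairs by blast+
    have "closedin Y {snd p}" using Hausdorff_Y p by (simp add: closedin_Hausdorff_singleton)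
    then obtain b where b: "continuous_map Y (top_of_set {0..1::real}) b" "b (fst p) = 0" "b ` {snd p} \<subseteq> {1}"
      using regular_Y p unfolding completely_regular_space_def by (metis DiffI singletonD)
    then show ?thesis by (intro exI[of _ b]) (auto simp: continuous_map_in_subtopology)
  qed
  then obtain b where b: "\<And>p. p \<in> C \<Longrightarrow> continuous_map Y euclideanreal (b p)"
    "\<And>p. p \<in> C \<Longrightarrow> b p (fst p) \<noteq> b p (snd p)" by metis
  define U where "U p = {u \<in> topspace ordered_pairs. b p (fst u) - b p (snd u) \<in> - {0}}" for p
  have U: "openin ordered_pairs (U p)" if "p \<in> C" for p
    unfolding U_def
  proof (rule openin_continuous_map_preimage[where Y = euclideanreal])
    have "continuous_map ordered_pairs Y fst" "continuous_map ordered_pairs Y snd"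
      unfolding ordered_config2_def
      by (auto intro: continuous_map_from_subtopology continuous_map_fst continuous_map_snd)
    from this[THEN continuous_map_compose, OF b(1)[OF that]]
    show "continuous_map ordered_pairs euclideanreal (\<lambda>u. b p (fst u) - b p (snd u))"
      by (intro continuous_map_diff) (simp_all add: o_def)
  qed (auto simp: open_Compl)
  have "C \<subseteq> \<Union>(U ` C)" using b(2) CF by (auto simp: U_def)
  then obtain \<F> where "finite \<F>" "\<F> \<subseteq> U ` C" "C \<subseteq> \<Union>\<F>"
    using C U unfolding compactin_def by (metis (no_types, lifting) imageE)
  then obtain P where P: "finite P" "P \<subseteq> C" "C \<subseteq> \<Union>(U ` P)" by (metis finite_subset_image)
  show thesis
  proof (rule that[of "b ` P"])
    show "\<exists>b'\<in>b ` P. b' (fst p) \<noteq> b' (snd p)" if "p \<in> C" for p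
      using P(3) that by (auto simp: U_def)
  qed (use P b in auto)
qed


text \<open>Let \<open>p x\<close> be the unordered pair of \<open>f x\<close> and \<open>f (-x)\<close>, and let \<open>h\<close> and \<open>k\<close> be inverse
  homotopy equivalences between unordered pairs and \<open>X\<close>.  The space \<open>P\<close> consists of the points \<open>\<xi>\<close>
  in the compact image of \<open>q = h \<circ> p\<close> together with an ordering of the pair \<open>k \<xi>\<close>; it carries an odd
  family \<open>\<psi>\<close> of \<open>N\<close> functions without common zero.  Over \<open>x\<close>, the section \<open>u\<close> of the line field
  of differences at the end \<open>p x\<close> of the homotopy, given by the ordering \<open>(f x, f (-x))\<close>, is
  transported to a section \<open>v\<close> at the other end \<open>k (q x)\<close>.  The products of \<open>\<psi>\<close> with the
  differences do not depend on the ordering of \<open>k \<xi>\<close>, so they are functions \<open>r\<close> of \<open>\<xi>\<close>, and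
  pairing them with \<open>v\<close> gives an odd family on the sphere without common zero.\<close>

theorem BUP_if_unordered_pairs_low_dimensional:
  fixes X :: "'b topology"
  assumes CW: "CW_complex X E" and equiv: "X homotopy_equivalent_space unordered_pairs"
    and dim: "\<And>n. E n \<noteq> {} \<Longrightarrow> n < N" and "N \<le> M"
  shows "BUP (nsphere M) antipode Y"
  unfolding BUP_def
proof (intro allI impI, rule ccontr)
  fix f assume f: "continuous_map (nsphere M) Y f"
    and no_coincidence: "\<not> (\<exists>x\<in>topspace (nsphere M). f (antipode x) = f x)"
  let ?S = "nsphere M" and ?I = "top_of_set {0..1::real}"
  have anti: "continuous_map ?S ?S antipode" "\<And>x. antipode (antipode x) = x"
    using free_involution_antipode[of M] by (auto simp: free_involution_def antipode_def)
  have anti_in: "antipode x \<in> topspace ?S" if "x \<in> topspace ?S" for x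
    using anti(1) that by (auto simp: continuous_map_def)
  have cptS: "compactin ?S (topspace ?S)"
    using compact_space_nsphere[of M] by (simp add: compact_space_def)
  define g where "g x = (f x, f (antipode x))" for x
  have g: "continuous_map ?S ordered_pairs g"
  proof -
    have "continuous_map ?S (prod_topology Y Y) g"
      unfolding g_def using continuous_map_compose[OF anti(1) f]
      by (intro continuous_map_pairedI f) (simp add: o_def)
    then show ?thesis
      using no_coincidence
      by (auto simp: ordered_config2_def continuous_map_in_subtopology g_def)
  qed
  have swap_g: "g (antipode x) = prod.swap (g x)" for x by (simp add: g_def anti)
  have forget: "continuous_map ordered_pairs unordered_pairs forget_order"
    "forget_order ` topspace ordered_pairs = topspace unordered_pairs"
    using perfect_map_forget_order by (auto simp: perfect_map_def)
  define p where "p x = forget_order (g x)" for x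
  have p: "continuous_map ?S unordered_pairs p"
    using continuous_map_compose[OF g forget(1)] by (simp add: p_def[abs_def] o_def)
  have p_even: "p (antipode x) = p x" for x by (auto simp: p_def swap_g)

  obtain k h where k: "continuous_map X unordered_pairs k" and h: "continuous_map unordered_pairs X h"
    and hom: "homotopic_with (\<lambda>_. True) unordered_pairs unordered_pairs (k \<circ> h) id"
    using equiv unfolding homotopy_equivalent_space_def by blast
  obtain H where H: "continuous_map (prod_topology ?I unordered_pairs) unordered_pairs H"
    "\<And>y. H (0, y) = k (h y)" "\<And>y. H (1, y) = y"
    using hom unfolding homotopic_with_def by auto
  define G where "G z = H (fst z, p (snd z))" for z
  have G: "continuous_map (prod_topology ?I ?S) unordered_pairs G"
  proof -
    have "continuous_map (prod_topology ?I ?S) (prod_topology ?I unordered_pairs)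
        (\<lambda>z. (fst z, p (snd z)))"
      using continuous_map_compose[OF continuous_map_snd p]
      by (intro continuous_map_pairedI continuous_map_fst) (simp add: o_def)
    then show ?thesis
      using continuous_map_compose[OF _ H(1)] by (simp add: G_def[abs_def] o_def)
  qed
  have topIS: "topspace (prod_topology ?I ?S) = {0..1} \<times> topspace ?S" by simp
  have G_in: "G (t, x) \<in> topspace unordered_pairs" if "t \<in> {0..1}" "x \<in> topspace ?S" for t x
    using G that unfolding continuous_map_def topIS by blast
  define C where "C = {u \<in> topspace ordered_pairs. forget_order u \<in> G ` ({0..1} \<times> topspace ?S)}"
  have C: "compactin ordered_pairs C"
    unfolding C_def
  proof (rule compactin_proper_map_preimage)
    have "compact_space (prod_topology ?I ?S)"
      by (simp add: compact_space_prod_topology compact_space_nsphere compact_space_subtopology)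
    then show "compactin unordered_pairs (G ` ({0..1} \<times> topspace ?S))"
      using image_compactin[OF _ G, of "topspace (prod_topology ?I ?S)"]
      by (simp add: compact_space_def topIS)
  qed (use perfect_map_forget_order in \<open>simp add: perfect_map_def\<close>)

  define q where "q x = h (p x)" for x
  have q: "continuous_map ?S X q"
    using continuous_map_compose[OF p h] by (simp add: q_def[abs_def] o_def)
  define Q where "Q = q ` topspace ?S"
  have Q: "compactin X Q" unfolding Q_def using cptS q by (rule image_compactin)
  have QX: "Q \<subseteq> topspace X" using Q by (rule compactin_subset_topspace)
  have Hausdorff_X: "Hausdorff_space X" using CW by (rule Hausdorff_CW)
  have kQ: "k \<xi> \<in> G ` ({0..1} \<times> topspace ?S)" if \<xi>: "\<xi> \<in> Q" for \<xi>
  proof -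
    obtain x where "x \<in> topspace ?S" "\<xi> = q x" using \<xi> by (auto simp: Q_def)
    then have "k \<xi> = G (0, x)" by (simp add: G_def H q_def)
    then show ?thesis using \<open>x \<in> topspace ?S\<close> by auto
  qed
  let ?XF = "prod_topology X ordered_pairs"
  define P where "P = {z \<in> topspace ?XF. fst z \<in> Q \<and> forget_order (snd z) = k (fst z)}"
  define \<sigma> where "\<sigma> z = (fst z, prod.swap (snd z))" for z :: "'b \<times> 'a \<times> 'a"
  let ?Z = "subtopology ?XF P"
  have PZ: "topspace ?Z = P" by (auto simp: P_def)
  have PC: "snd z \<in> C" if "z \<in> P" for z
    using that kQ by (auto simp: P_def C_def)
  have \<sigma>P: "\<sigma> z \<in> P" if "z \<in> P" for z
    using that by (auto simp: P_def \<sigma>_def topspace_ordered_pairs)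
  have "compactin ?XF P"
  proof -
    have "closedin ?XF {z \<in> topspace ?XF. forget_order (snd z) = k (fst z)}"
      using continuous_map_compose[OF continuous_map_snd forget(1)]
        continuous_map_compose[OF continuous_map_fst k]
      by (intro closedin_continuous_maps_eq[OF Hausdorff_unordered_pairs]) (simp_all add: o_def)
    moreover have "compactin ?XF (Q \<times> C)" using Q C by (simp add: compactin_Times)
    ultimately have "compactin ?XF ({z \<in> topspace ?XF. forget_order (snd z) = k (fst z)} \<inter> (Q \<times> C))"
      by (rule closed_Int_compactin)
    moreover have "{z \<in> topspace ?XF. forget_order (snd z) = k (fst z)} \<inter> (Q \<times> C) = P"
    proof (intro equalityI subsetI)
      fix z assume "z \<in> P"
      then show "z \<in> {z \<in> topspace ?XF. forget_order (snd z) = k (fst z)} \<inter> (Q \<times> C)"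
        using PC[of z] by (cases z) (auto simp: P_def)
    qed (auto simp: P_def)
    ultimately show ?thesis by simp
  qed
  have Z: "compact_free_involution ?Z \<sigma>"
  proof
    show "compact_space ?Z" using \<open>compactin ?XF P\<close> by (rule compact_space_subtopology)
    show "Hausdorff_space ?Z"
      by (simp add: Hausdorff_space_subtopology Hausdorff_space_prod_topology Hausdorff_X
          Hausdorff_ordered_pairs)
    have "continuous_map ?XF ?XF \<sigma>"
      unfolding \<sigma>_def
      using continuous_map_compose[OF continuous_map_snd continuous_map_swap_ordered_pairs]
      by (intro continuous_map_pairedI continuous_map_fst) (simp add: o_def)
    then have "continuous_map ?Z ?Z \<sigma>"
      using \<sigma>P by (auto simp: continuous_map_in_subtopology continuous_map_from_subtopology PZ)
    moreover have "\<sigma> z \<noteq> z" if "z \<in> P" for z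
    proof -
      have "fst (snd z) \<noteq> snd (snd z)"
        using that by (auto simp: P_def topspace_ordered_pairs)
      then show ?thesis by (auto simp: \<sigma>_def prod_eq_iff)
    qed
    ultimately show "free_involution ?Z \<sigma>"
      unfolding free_involution_def PZ by (simp add: \<sigma>_def)
  qed
  have fst_Z: "continuous_map ?Z X fst"
    by (intro continuous_map_from_subtopology continuous_map_fst)
  have Z_fibre: "z' = z \<or> z' = \<sigma> z" if "z \<in> P" "z' \<in> P" "fst z = fst z'" for z z'
  proof -
    have "forget_order (snd z) = forget_order (snd z')" using that by (simp add: P_def)
    then show ?thesis using that(3) by (auto simp: forget_order_eq_iff \<sigma>_def prod_eq_iff)
  qed
  obtain \<psi> where \<psi>: "odd_family ?Z \<sigma> N \<psi>" "nonvanishing_on N \<psi> P"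
  proof (rule odd_family_over_CW_complex[OF CW Z fst_Z])
    show "z' = z \<or> z' = \<sigma> z"
      if "z \<in> topspace ?Z" "z' \<in> topspace ?Z" "fst z = fst z'" for z z'
      using that Z_fibre unfolding PZ by blast
  qed (use dim that PZ in \<open>auto simp: \<sigma>_def\<close>)

  obtain B :: "('a \<Rightarrow> real) set" where B: "finite B"
    "\<And>b. b \<in> B \<Longrightarrow> continuous_map Y euclideanreal b"
    "\<And>u. u \<in> C \<Longrightarrow> \<exists>b\<in>B. b (fst u) \<noteq> b (snd u)"
    using finite_separating_family[OF C] by blast
  define diff where "diff b u = b (fst u) - b (snd u)" for b :: "'a \<Rightarrow> real" and u
  have diff_swap: "diff b (prod.swap u) = - diff b u" for b u by (simp add: diff_def)
  have diff: "continuous_map ordered_pairs euclideanreal (diff b)" if "b \<in> B" for b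
  proof -
    have "continuous_map ordered_pairs Y fst" "continuous_map ordered_pairs Y snd"
      unfolding ordered_config2_def
      by (auto intro: continuous_map_from_subtopology continuous_map_fst continuous_map_snd)
    from this[THEN continuous_map_compose, OF B(2)[OF that]]
    show ?thesis unfolding diff_def by (intro continuous_map_diff) (simp_all add: o_def)
  qed
  \<comment> \<open>An arbitrary, in general discontinuous, choice of an ordering; reversing it changes the sign of
    all differences at once and hence no product of two of them.\<close>
  define pick where "pick y = (SOME u. u \<in> topspace ordered_pairs \<and> forget_order u = y)" for y
  have pick: "pick y \<in> topspace ordered_pairs" "forget_order (pick y) = y"
    if "y \<in> topspace unordered_pairs" for y
  proof -
    have "\<exists>u. u \<in> topspace ordered_pairs \<and> forget_order u = y"
      using that unfolding forget(2)[symmetric] by blast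
    then have "pick y \<in> topspace ordered_pairs \<and> forget_order (pick y) = y"
      unfolding pick_def by (rule someI_ex)
    then show "pick y \<in> topspace ordered_pairs" "forget_order (pick y) = y" by auto
  qed
  have pick_cases: "pick (forget_order u) = u \<or> pick (forget_order u) = prod.swap u"
    if "u \<in> topspace ordered_pairs" for u
  proof -
    have "forget_order u \<in> topspace unordered_pairs" using that forget(2) by blast
    then have "forget_order (pick (forget_order u)) = forget_order u" by (rule pick(2))
    then show ?thesis by (metis forget_order_eq_iff)
  qed
  define a where "a b z = diff b (pick (G z))" for b z
  have pick_C: "pick (G (t, x)) \<in> C" if "t \<in> {0..1}" "x \<in> topspace ?S" for t x
    using pick[OF G_in[OF that]] that by (auto simp: C_def)
  have a_cont: "continuous_map (prod_topology ?I ?S) euclideanreal (\<lambda>z. a b z * a b' z)"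
    if "b \<in> B" "b' \<in> B" for b b'
  proof -
    have cont: "continuous_map ordered_pairs euclideanreal (\<lambda>u. diff b u * diff b' u)"
      using that by (intro continuous_map_real_mult diff)
    have even: "diff b u * diff b' u = diff b u' * diff b' u'"
      if "forget_order u = forget_order u'" for u u'
      using that unfolding forget_order_eq_iff by (auto simp: diff_swap)
    obtain \<pi> where \<pi>: "continuous_map unordered_pairs euclideanreal \<pi>"
      "\<And>u. u \<in> topspace ordered_pairs \<Longrightarrow> \<pi> (forget_order u) = diff b u * diff b' u"
      by (rule quotient_map_lift_exists[OF quotient_map_forget_order cont even])
        (assumption | rule that; assumption)+
    have "continuous_map (prod_topology ?I ?S) euclideanreal (\<lambda>z. \<pi> (G z))"
      using continuous_map_compose[OF G \<pi>(1)] by (simp add: o_def)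
    moreover have "\<pi> (G z) = a b z * a b' z" if z: "z \<in> topspace (prod_topology ?I ?S)" for z
    proof -
      have "G z \<in> topspace unordered_pairs" using G z by (auto simp: continuous_map_def)
      from pick[OF this] show ?thesis using \<pi>(2)[of "pick (G z)"] by (simp add: a_def)
    qed
    ultimately show ?thesis by (rule continuous_map_eq)
  qed
  obtain v where v: "\<And>b. b \<in> B \<Longrightarrow> continuous_map ?S euclideanreal (v b)"
    "\<And>b x. \<lbrakk>b \<in> B; x \<in> topspace ?S\<rbrakk> \<Longrightarrow> v b (antipode x) = - v b x"
    "\<And>x. x \<in> topspace ?S \<Longrightarrow> \<exists>c. c \<noteq> 0 \<and> (\<forall>b\<in>B. v b x = c * a b (0, x))"
  proof (rule line_field_transport[OF \<open>finite B\<close> compact_space_nsphere anti_in a_cont,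
        where u = "\<lambda>b x. diff b (g x)"])
    show "\<exists>b\<in>B. a b (t, x) \<noteq> 0" if "t \<in> {0..1}" "x \<in> topspace ?S" for t x
      using B(3)[OF pick_C[OF that]] by (auto simp: a_def diff_def)
    show "a b (t, antipode x) = a b (t, x)" for b t x
      by (simp add: a_def G_def p_even)
    show "continuous_map ?S euclideanreal (\<lambda>x. diff b (g x))" if "b \<in> B" for b
      using continuous_map_compose[OF g diff[OF that]] by (simp add: o_def)
    show "diff b (g (antipode x)) = - diff b (g x)" for b x by (simp add: swap_g diff_swap)
    show "\<exists>c. c \<noteq> 0 \<and> (\<forall>b\<in>B. diff b (g x) = c * a b (1, x))" if "x \<in> topspace ?S" for x
    proof -
      have "g x \<in> topspace ordered_pairs" using g that by (auto simp: continuous_map_def)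
      then have "pick (p x) = g x \<or> pick (p x) = prod.swap (g x)"
        using pick_cases unfolding p_def by blast
      then show ?thesis
      proof
        assume "pick (p x) = g x"
        then show ?thesis by (intro exI[of _ 1]) (simp add: a_def G_def H)
      next
        assume "pick (p x) = prod.swap (g x)"
        then show ?thesis by (intro exI[of _ "-1"]) (simp add: a_def G_def H diff_swap)
      qed
    qed
  qed (assumption | rule that; assumption)+

  have "quotient_map ?Z (subtopology X Q) fst"
  proof (rule continuous_closed_imp_quotient_map)
    show cont: "continuous_map ?Z (subtopology X Q) fst"
      using fst_Z by (auto simp: continuous_map_in_subtopology P_def)
    have "Hausdorff_space (subtopology X Q)" using Hausdorff_X by (rule Hausdorff_space_subtopology)
    then show "closed_map ?Z (subtopology X Q) fst"
      using cont \<open>compactin ?XF P\<close>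
      by (intro continuous_imp_closed_map_gen) (auto simp: compact_space_subtopology Hausdorff_imp_kc_space)
    show "fst ` topspace ?Z = topspace (subtopology X Q)"
    proof (intro equalityI subsetI)
      fix \<xi> assume "\<xi> \<in> topspace (subtopology X Q)"
      then have \<xi>: "\<xi> \<in> Q" "\<xi> \<in> topspace X" by auto
      then have "k \<xi> \<in> topspace unordered_pairs" using k by (auto simp: continuous_map_def)
      from pick[OF this] have "(\<xi>, pick (k \<xi>)) \<in> P" using \<xi> by (simp add: P_def)
      then show "\<xi> \<in> fst ` topspace ?Z" unfolding PZ by force
    qed (auto simp: P_def)
  qed
  note lift = quotient_map_lift_exists[OF this]
  define descends where "descends j b r \<longleftrightarrow> continuous_map (subtopology X Q) euclideanreal r \<and>
      (\<forall>z\<in>P. r (fst z) = \<psi> j z * diff b (snd z))" for j b r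
  have "\<exists>r. descends j b r" if j: "j < N" and b: "b \<in> B" for j b
  proof -
    have snd_Z: "continuous_map ?Z ordered_pairs snd"
      by (intro continuous_map_from_subtopology continuous_map_snd)
    have cont: "continuous_map ?Z euclideanreal (\<lambda>z. \<psi> j z * diff b (snd z))"
      using \<psi>(1) j continuous_map_compose[OF snd_Z diff[OF b]]
      by (intro continuous_map_real_mult) (simp_all add: odd_family_def o_def)
    have even: "\<psi> j z * diff b (snd z) = \<psi> j z' * diff b (snd z')"
      if "z \<in> topspace ?Z" "z' \<in> topspace ?Z" "fst z = fst z'" for z z'
    proof -
      have "z' = z \<or> z' = \<sigma> z" using Z_fibre that unfolding PZ by blast
      moreover have "\<psi> j (\<sigma> z) = - \<psi> j z" using \<psi>(1) j that(1) by (simp add: odd_family_def)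
      moreover have "diff b (snd (\<sigma> z)) = - diff b (snd z)" by (simp add: \<sigma>_def diff_swap)
      ultimately show ?thesis by auto
    qed
    obtain r where r: "continuous_map (subtopology X Q) euclideanreal r"
      "\<And>z. z \<in> topspace ?Z \<Longrightarrow> r (fst z) = \<psi> j z * diff b (snd z)"
      by (rule lift[OF cont even]) (assumption | rule that; assumption)+
    then show ?thesis unfolding PZ descends_def by (intro exI[of _ r]) simp
  qed
  then obtain r where descends: "\<And>j b. \<lbrakk>j < N; b \<in> B\<rbrakk> \<Longrightarrow> descends j b (r j b)" by metis
  have r: "continuous_map (subtopology X Q) euclideanreal (r j b)"
    "\<And>z. z \<in> P \<Longrightarrow> r j b (fst z) = \<psi> j z * diff b (snd z)" if "j < N" "b \<in> B" for j b
    using descends[OF that] unfolding descends_def by blast+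
  define w where "w j x = (\<Sum>b\<in>B. v b x * r j b (q x))" for j x
  have qQ: "continuous_map ?S (subtopology X Q) q"
    using q by (auto simp: continuous_map_in_subtopology Q_def)
  have "odd_family ?S antipode N w"
    unfolding odd_family_def
  proof (intro allI impI conjI ballI)
    fix j assume j: "j < N"
    have "continuous_map ?S euclideanreal (\<lambda>x. r j b (q x))" if "b \<in> B" for b
      using continuous_map_compose[OF qQ r(1)[OF j that]] by (simp add: o_def)
    then show "continuous_map ?S euclideanreal (w j)"
      unfolding w_def using \<open>finite B\<close> v(1) by (intro continuous_map_sum continuous_map_real_mult)
    show "w j (antipode x) = - w j x" if "x \<in> topspace ?S" for x
      using v(2)[OF _ that] by (simp add: w_def q_def p_even sum_negf)
  qed
  moreover have "nonvanishing_on N w (topspace ?S)"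
    unfolding nonvanishing_on_def
  proof
    fix x assume x: "x \<in> topspace ?S"
    define u where "u = pick (k (q x))"
    have G0: "G (0, x) = k (q x)" by (simp add: G_def H q_def)
    have u: "u \<in> C" "u \<in> topspace ordered_pairs" "forget_order u = k (q x)"
      using pick_C[of 0 x] pick[OF G_in[of 0 x]] x G0 by (auto simp: u_def)
    have z: "(q x, u) \<in> P" using u x QX by (auto simp: P_def Q_def)
    obtain j where j: "j < N" "\<psi> j (q x, u) \<noteq> 0" using \<psi>(2) z by (auto simp: nonvanishing_on_def)
    obtain c where c: "c \<noteq> 0" "\<forall>b\<in>B. v b x = c * a b (0, x)" using v(3)[OF x] by blast
    obtain b where b: "b \<in> B" "diff b u \<noteq> 0" using B(3)[OF u(1)] by (auto simp: diff_def)
    have "0 < (diff b u)\<^sup>2" using b by simp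
    also have "\<dots> \<le> (\<Sum>b\<in>B. (diff b u)\<^sup>2)" using b \<open>finite B\<close> by (intro member_le_sum) auto
    finally have pos: "0 < (\<Sum>b\<in>B. (diff b u)\<^sup>2)" .
    \<comment> \<open>At \<open>x\<close> the pairing is \<open>\<psi>\<close> times \<open>c\<close> times the squared norm of the vector of differences.\<close>
    have "w j x = (\<Sum>b\<in>B. (c * \<psi> j (q x, u)) * (diff b u)\<^sup>2)"
      unfolding w_def
    proof (rule sum.cong)
      fix b assume b: "b \<in> B"
      have "r j b (q x) = \<psi> j (q x, u) * diff b u" using r(2)[OF j(1) b z] by simp
      moreover have "v b x = c * diff b u" using c(2) b by (simp add: a_def G0 u_def)
      ultimately show "v b x * r j b (q x) = (c * \<psi> j (q x, u)) * (diff b u)\<^sup>2"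
        by (simp add: power2_eq_square)
    qed simp
    also have "\<dots> = (c * \<psi> j (q x, u)) * (\<Sum>b\<in>B. (diff b u)\<^sup>2)" by (simp add: sum_distrib_left)
    finally show "\<exists>j<N. w j x \<noteq> 0" using pos c(1) j by (intro exI[of _ j]) auto
  qed
  ultimately show False using Borsuk_Ulam_odd_family \<open>N \<le> M\<close> by blast
qed

end

theorem proposition3p17:
  fixes m d :: nat and Y :: "'a topology"
  assumes "topological_manifold d Y"
    and "path_connected_space Y"
    and "real d \<le> real m / 2"
  shows "BUP (nsphere (m + 1)) antipode Y \<and>
    (hdim TYPE('b) (unordered_config2 Y) \<le> ereal (2 * real d - 1) \<longrightarrow>
      BUP (nsphere m) antipode Y)"
proof (intro conjI impI)
  have m: "2 * d \<le> m" using assms(3) by linarith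
  then show "BUP (nsphere (m + 1)) antipode Y"
    using assms(1) by (intro BUP_manifold_of_small_dimension) auto
  assume "hdim TYPE('b) (unordered_config2 Y) \<le> ereal (2 * real d - 1)"
  then obtain X :: "'b topology" and E where CW: "CW_complex X E"
    "X homotopy_equivalent_space unordered_config2 Y" "CW_dim E \<le> ereal (2 * real d - 1)"
    unfolding hdim_le_iff by blast
  have dim: "n < 2 * d" if "E n \<noteq> {}" for n
  proof -
    have "ereal (real n) \<le> CW_dim E" unfolding CW_dim_def using that by (intro SUP_upper) auto
    then have "ereal (real n) \<le> ereal (2 * real d - 1)" using CW(3) by (rule order_trans)
    then have "real n \<le> 2 * real d - 1" by (simp only: ereal_less_eq)
    then show ?thesis by linarith
  qed
  have Y: "Hausdorff_space Y" using assms(1) by (simp add: topological_manifold_def)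
  then have "completely_regular_space Y"
    using manifold_locally_compact[OF assms(1)] locally_compact_regular_imp_completely_regular_space
    by blast
  then show "BUP (nsphere m) antipode Y"
    using BUP_if_unordered_pairs_low_dimensional[OF Y _ CW(1,2) dim m] by blast
qed

end
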